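(* Let $o\in\mathbb{H}^{p,q-1}$, $\tau\in S^o$, and let $\mathfrak{b}^+$ be a closed Weyl chamber of a maximal subalgebra $\mathfrak{b}\subset\mathfrak{p}^\tau\cap\mathfrak{q}^o$, with associated polar projection $b^\tau:G\to\mathfrak{b}^+$. For every $g\in G$ one has $$|b^\tau(g)|^{1/2}=d_{X_G}(g^{-1}\cdot\tau,S^o).$$
   Context: Fix integers $p,q\ge1$ with $d:=p+q>2$. On $\mathbb{R}^d$ let $\langle x,y\rangle_{p,q}:=\sum_{i=1}^p x_iy_i-\sum_{i=p+1}^d x_iy_i$, with orthogonal complements denoted $\cdot^{\perp_{p,q}}$. $G:=\mathrm{PSO}(p,q)\subset\mathrm{PSL}(d,\mathbb{R})$ is the group of projectivized matrices of $\mathrm{SL}(d,\mathbb{R})$ preserving the form, with Lie algebra $\mathfrak{g}=\mathfrak{so}(p,q)$ and Killing form $\kappa(X,Y)=(d-2)\mathrm{tr}(XY)$. $\mathbb{H}^{p,q-1}:=\{o=[\hat o]\in\mathbb{P}(\mathbb{R}^d):\langle\hat o,\hat o\rangle_{p,q}<0\}$. For $o\in\mathbb{H}^{p,q-1}$ let $J^o:=\mathrm{id}_o\oplus(-\mathrm{id}_{o^{\perp_{p,q}}})$, $H^o$ the stabilizer of $o$ in $G$, $\mathfrak{q}^o:=\{X\in\mathfrak{g}:J^oXJ^o=-X\}$, and for $X\in\mathfrak{q}^o$ put $|X|:=\frac{1}{2(d-2)}\kappa(X,X)$. $X_G$ is the space of $q$-dimensional negative definite subspaces $\tau$ of $\mathbb{R}^d$;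 $S^o:=\{\tau\in X_G:o\subset\tau\}$. For $\tau\in X_G$, $K^\tau$ is its stabilizer in $G$, $\langle\cdot,\cdot\rangle_\tau$ is the inner product equal to $-\langle\cdot,\cdot\rangle_{p,q}$ on $\tau$, to $\langle\cdot,\cdot\rangle_{p,q}$ on $\tau^{\perp_{p,q}}$ and making these orthogonal; $\mathfrak{p}^\tau$ is the set of $X\in\mathfrak{g}$ symmetric for $\langle\cdot,\cdot\rangle_\tau$, identified with $T_\tau X_G$. $d_{X_G}$ is the distance of the $G$-invariant Riemannian metric with $d_{X_G}(\tau,\exp(X)\cdot\tau)=(\frac{1}{2(d-2)}\kappa(X,X))^{1/2}$ for $X\in\mathfrak{p}^\tau$; $d_{X_G}(x,B):=\inf\{d_{X_G}(x,b):b\in B\}$. For $\tau\in S^o$, a maximal subalgebra $\mathfrak{b}\subset\mathfrak{p}^\tau\cap\mathfrak{q}^o$ is abelian and one-dimensional; a closed Weyl chamber $\mathfrak{b}^+$ is a closed half-line of $\mathfrak{b}$ starting at $0$. One has $G=K^\tau\exp(\mathfrak{b}^+)H^o$ with unique $\exp(\mathfrak{b}^+)$-component, and $b^\tau:G\to\mathfrak{b}^+$ is defined by $g\in K^\tau\exp(b^\tau(g))H^o$. *)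

theory Defs
  imports "HOL-Analysis.Analysis" "HOL-Algebra.Coset"
begin

text \<open>
  The two index types carry the signature: \<open>p = CARD('p)\<close> and \<open>q = CARD('q)\<close> are arbitrary
  positive integers and \<open>d = CARD('p + 'q) = p + q\<close>.
\<close>

type_synonym ('p, 'q) vec_pq = "real ^ ('p + 'q)"
type_synonym ('p, 'q) mat_pq = "real ^ ('p + 'q) ^ ('p + 'q)"

definition form :: "('p::finite, 'q::finite) vec_pq \<Rightarrow> ('p, 'q) vec_pq \<Rightarrow> real" where
  "form x y = (\<Sum>i\<in>UNIV. x $ Inl i * y $ Inl i) - (\<Sum>j\<in>UNIV. x $ Inr j * y $ Inr j)"

definition form_perp :: "('p::finite, 'q::finite) vec_pq set \<Rightarrow> ('p, 'q) vec_pq set" where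
  "form_perp W = {x. \<forall>y\<in>W. form x y = 0}"

text \<open>
  \<open>PSL(d, \<real>)\<close> is the quotient of \<open>SL(d, \<real>)\<close> by its scalar matrices, so that an element of
  \<open>PSL(d, \<real>)\<close> is a set of matrices, and \<open>PSO(p, q)\<close> is the image of the group of
  form-preserving matrices under the quotient map \<open>projectivize\<close>.
\<close>

definition SL :: "(real ^ 'n::finite ^ 'n) monoid" where
  "SL = \<lparr>carrier = {A. det A = 1}, mult = (**), one = mat 1\<rparr>"

definition scalars :: "(real ^ 'n::finite ^ 'n) set" where
  "scalars = {A \<in> carrier SL. \<exists>c. A = mat c}"

definition PSL :: "(real ^ 'n::finite ^ 'n) set monoid" where
  "PSL = SL Mod scalars"

definition projectivize :: "real ^ 'n::finite ^ 'n \<Rightarrow> (real ^ 'n ^ 'n) set" where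
  "projectivize A = scalars #>\<^bsub>SL\<^esub> A"

definition SO :: "('p::finite, 'q::finite) mat_pq set" where
  "SO = {A \<in> carrier SL. \<forall>x y. form (A *v x) (A *v y) = form x y}"

definition PSO :: "('p::finite, 'q::finite) mat_pq set monoid" where
  "PSO = PSL\<lparr>carrier := projectivize ` SO\<rparr>"

text \<open>
  All representatives of a class map a linear subspace to the same subspace, so the union
  below is just the image under any one of them.
\<close>

definition act :: "(real ^ 'n::finite ^ 'n) set \<Rightarrow> (real ^ 'n) set \<Rightarrow> (real ^ 'n) set" where
  "act g W = (\<Union>A\<in>g. (*v) A ` W)"

definition stabilizer :: "('p::finite, 'q::finite) vec_pq set \<Rightarrow> ('p, 'q) mat_pq set set" where
  "stabilizer W = {g \<in> carrier PSO. act g W = W}"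

definition so :: "('p::finite, 'q::finite) mat_pq set" where
  "so = {X. \<forall>x y. form (X *v x) y + form x (X *v y) = 0}"

definition lie_bracket :: "real ^ 'n::finite ^ 'n \<Rightarrow> real ^ 'n ^ 'n \<Rightarrow> real ^ 'n ^ 'n" where
  "lie_bracket X Y = X ** Y - Y ** X"

definition killing :: "('p::finite, 'q::finite) mat_pq \<Rightarrow> ('p, 'q) mat_pq \<Rightarrow> real" where
  "killing X Y = (real CARD('p + 'q) - 2) * trace (X ** Y)"

definition normalized_killing :: "('p::finite, 'q::finite) mat_pq \<Rightarrow> ('p, 'q) mat_pq \<Rightarrow> real" where
  "normalized_killing X Y = 1 / (2 * (real CARD('p + 'q) - 2)) * killing X Y"

text \<open>This is the quadratic quantity \<open>|X|\<close>; it scales as \<open>|t X| = t\<^sup>2 |X|\<close>.\<close>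

definition abs_q :: "('p::finite, 'q::finite) mat_pq \<Rightarrow> real" where
  "abs_q X = normalized_killing X X"

definition mexp :: "real ^ 'n::finite ^ 'n \<Rightarrow> real ^ 'n ^ 'n" where
  "mexp X = (\<Sum>n. (1 / fact n) *\<^sub>R (((**) X) ^^ n) (mat 1))"

text \<open>Points of projective space are represented by the corresponding lines of \<open>\<real>\<^sup>d\<close>.\<close>

definition Hpq :: "('p::finite, 'q::finite) vec_pq set set" where
  "Hpq = {span {v} | v. form v v < 0}"

definition J_inv :: "('p::finite, 'q::finite) vec_pq set \<Rightarrow> ('p, 'q) mat_pq" where
  "J_inv \<omega> = (THE J. (\<forall>x\<in>\<omega>. J *v x = x) \<and> (\<forall>x\<in>form_perp \<omega>. J *v x = - x))"

definition q_space :: "('p::finite, 'q::finite) vec_pq set \<Rightarrow> ('p, 'q) mat_pq set" where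
  "q_space \<omega> = {X \<in> so. J_inv \<omega> ** X ** J_inv \<omega> = - X}"

definition XG :: "('p::finite, 'q::finite) vec_pq set set" where
  "XG = {\<tau>. subspace \<tau> \<and> dim \<tau> = CARD('q) \<and> (\<forall>x\<in>\<tau>. x \<noteq> 0 \<longrightarrow> form x x < 0)}"

definition S_sub :: "('p::finite, 'q::finite) vec_pq set \<Rightarrow> ('p, 'q) vec_pq set set" where
  "S_sub \<omega> = {\<tau> \<in> XG. \<omega> \<subseteq> \<tau>}"

text \<open>The projection onto \<open>\<tau>\<close> along its form-orthogonal complement.\<close>

definition form_proj ::
  "('p::finite, 'q::finite) vec_pq set \<Rightarrow> ('p, 'q) vec_pq \<Rightarrow> ('p, 'q) vec_pq" where
  "form_proj \<tau> x = (THE u. u \<in> \<tau> \<and> x - u \<in> form_perp \<tau>)"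

definition ip_tau ::
  "('p::finite, 'q::finite) vec_pq set \<Rightarrow> ('p, 'q) vec_pq \<Rightarrow> ('p, 'q) vec_pq \<Rightarrow> real" where
  "ip_tau \<tau> x y =
     - form (form_proj \<tau> x) (form_proj \<tau> y)
     + form (x - form_proj \<tau> x) (y - form_proj \<tau> y)"

definition p_space :: "('p::finite, 'q::finite) vec_pq set \<Rightarrow> ('p, 'q) mat_pq set" where
  "p_space \<tau> = {X \<in> so. \<forall>x y. ip_tau \<tau> (X *v x) y = ip_tau \<tau> x (X *v y)}"

text \<open>
  The manifold structure of \<open>X\<^sub>G\<close> is the one for which \<open>\<tau> \<mapsto> matrix (form_proj \<tau>)\<close> is a
  (\<open>G\<close>-equivariant) embedding into the space of matrices. In this picture the identification of
  \<open>p_space \<tau>\<close> with the tangent space at \<open>\<tau>\<close> sends \<open>X\<close> to the velocity at \<open>s = 0\<close> of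
  \<open>s \<mapsto> exp (s X) \<cdot> \<tau>\<close>. A continuously differentiable path in \<open>X\<^sub>G\<close> is thus a curve \<open>\<gamma>\<close> whose
  velocity is represented by a continuous field \<open>\<xi>\<close> with \<open>\<xi> t \<in> p_space (\<gamma> t)\<close>; the
  field is determined by \<open>\<gamma>\<close>.
\<close>

definition tangent_vector ::
  "('p::finite, 'q::finite) vec_pq set \<Rightarrow> ('p, 'q) mat_pq \<Rightarrow> ('p, 'q) mat_pq" where
  "tangent_vector \<tau> X =
     vector_derivative (\<lambda>s. matrix (form_proj ((*v) (mexp (s *\<^sub>R X)) ` \<tau>))) (at 0)"

definition C1_path_with_velocity ::
  "(real \<Rightarrow> ('p::finite, 'q::finite) vec_pq set) \<Rightarrow> (real \<Rightarrow> ('p, 'q) mat_pq) \<Rightarrow> bool" where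
  "C1_path_with_velocity \<gamma> \<xi> \<longleftrightarrow>
     continuous_on {0..1} \<xi> \<and>
     (\<forall>t\<in>{0..1}. \<gamma> t \<in> XG \<and> \<xi> t \<in> p_space (\<gamma> t) \<and>
        ((\<lambda>s. matrix (form_proj (\<gamma> s))) has_vector_derivative tangent_vector (\<gamma> t) (\<xi> t))
          (at t within {0..1}))"

text \<open>
  The Riemannian metric of \<open>X\<^sub>G\<close> is \<open>normalized_killing\<close> on each tangent space \<open>p_space \<tau>\<close>;
  it is \<open>G\<close>-invariant because the trace form is, and it is the only invariant metric for which
  \<open>\<tau>\<close> and \<open>exp X \<cdot> \<tau>\<close> are at distance \<open>sqrt (normalized_killing X X)\<close> for \<open>X \<in> p_space \<tau>\<close>.
\<close>

definition path_length :: "(real \<Rightarrow> ('p::finite, 'q::finite) mat_pq) \<Rightarrow> real" where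
  "path_length \<xi> = integral {0..1} (\<lambda>t. sqrt (normalized_killing (\<xi> t) (\<xi> t)))"

definition dist_XG ::
  "('p::finite, 'q::finite) vec_pq set \<Rightarrow> ('p, 'q) vec_pq set \<Rightarrow> real" where
  "dist_XG \<sigma> \<tau> =
     Inf {path_length \<xi> | \<gamma> \<xi>. C1_path_with_velocity \<gamma> \<xi> \<and> \<gamma> 0 = \<sigma> \<and> \<gamma> 1 = \<tau>}"

definition dist_XG_set ::
  "('p::finite, 'q::finite) vec_pq set \<Rightarrow> ('p, 'q) vec_pq set set \<Rightarrow> real" where
  "dist_XG_set \<tau> B = (INF \<sigma>\<in>B. dist_XG \<tau> \<sigma>)"

definition lie_subalgebra :: "('p::finite, 'q::finite) mat_pq set \<Rightarrow> bool" where
  "lie_subalgebra b \<longleftrightarrow> b \<subseteq> so \<and> subspace b \<and> (\<forall>X\<in>b. \<forall>Y\<in>b. lie_bracket X Y \<in> b)"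

definition maximal_subalgebra_in ::
  "('p::finite, 'q::finite) mat_pq set \<Rightarrow> ('p, 'q) mat_pq set \<Rightarrow> bool" where
  "maximal_subalgebra_in V b \<longleftrightarrow>
     lie_subalgebra b \<and> b \<subseteq> V \<and> (\<forall>c. lie_subalgebra c \<and> c \<subseteq> V \<and> b \<subseteq> c \<longrightarrow> c = b)"

text \<open>The subalgebras in question are one-dimensional, so their closed Weyl chambers are half-lines.\<close>

definition closed_weyl_chamber ::
  "('p::finite, 'q::finite) mat_pq set \<Rightarrow> ('p, 'q) mat_pq set \<Rightarrow> bool" where
  "closed_weyl_chamber b bplus \<longleftrightarrow> (\<exists>X\<in>b. X \<noteq> 0 \<and> bplus = {t *\<^sub>R X | t. t \<ge> 0})"

definition polar_proj ::
  "('p::finite, 'q::finite) vec_pq set \<Rightarrow> ('p, 'q) vec_pq set \<Rightarrow> ('p, 'q) mat_pq set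
    \<Rightarrow> ('p, 'q) mat_pq set \<Rightarrow> ('p, 'q) mat_pq" where
  "polar_proj \<omega> \<tau> bplus g =
     (THE Y. Y \<in> bplus \<and>
        (\<exists>k\<in>stabilizer \<tau>. \<exists>h\<in>stabilizer \<omega>.
           g = k \<otimes>\<^bsub>PSO\<^esub> projectivize (mexp Y) \<otimes>\<^bsub>PSO\<^esub> h))"

end

theory Submission
  imports Defs
begin

text \<open>
  Let \<open>v\<close> be a vector of norm \<open>-1\<close> spanning \<open>\<omega>\<close> and let \<open>P\<^sub>\<sigma>\<close> be the form-orthogonal
  projection onto \<open>\<sigma>\<close>. The invariant controlling everything is
  \<open>gap v \<sigma> = \<langle>v - P\<^sub>\<sigma> v, v - P\<^sub>\<sigma> v\<rangle> \<ge> 0\<close>, which vanishes on \<open>S_sub \<omega>\<close>. Writing \<open>g = k exp(tX) h\<close> with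
  the generator normalized so that \<open>exp(tX) v = cosh t v + sinh t w\<close>, the gap of \<open>v\<close> and
  \<open>g\<inverse>\<tau>\<close> is \<open>sinh\<^sup>2 t\<close>, and this determines \<open>t \<ge> 0\<close>. Along a path \<open>\<gamma>\<close> with velocity \<open>\<xi>\<close>, the
  derivative of the gap is \<open>-2\<langle>\<xi> a, b\<rangle>\<close> with \<open>a = P v\<close> and \<open>b = v - P v\<close>; by Cauchy--Schwarz for the
  trace form it is at most \<open>2 |\<xi>| sinh r cosh r\<close> when the gap is \<open>sinh\<^sup>2 r\<close>, so that \<open>r\<close> is
  1-Lipschitz and the distance to \<open>S_sub \<omega>\<close> is at least \<open>t\<close>. The path
  \<open>h\<inverse> exp((s-1)tX) \<tau>\<close> has length \<open>t\<close> and ends in \<open>S_sub \<omega>\<close>.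
\<close>

section \<open>The form and its negative definite subspaces\<close>

text \<open>\<open>dist_XG\<close> is an infimum over all C1 paths, so the lower bound has to hold
  path by path; the gap serves as a calibrating function for this. The obstacle is that
  \<open>arsinh (sqrt gap)\<close> is not smooth where the gap vanishes, which is exactly where the
  paths of interest end. \<open>polar_proj\<close> is a definite description, so the decomposition
  itself has to be established. Existence rests on the stabilizer of \<open>\<tau>\<close> acting
  transitively on pairs of vectors of prescribed norms, one in \<open>\<tau>\<close> and one in its
  complement. Group elements are matrices up to a scalar, and \<open>h\<close> preserves only the
  line \<open>\<omega>\<close>, so \<open>v\<close> is controlled only up to sign; the gap is
  quadratic in \<open>v\<close> and does not see the sign. The bound d > 2 enters twice: the factor
  d - 2 of the Killing form cancels, and there is room for a reflection that corrects a
  determinant.\<close>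

lemma bilinear_form: "bilinear form"
  unfolding bilinear_def form_def
  by (auto intro!: linearI simp: algebra_simps sum.distrib sum_distrib_left)

lemma bounded_bilinear_form: "bounded_bilinear form"
  using bilinear_form by (simp add: bilinear_conv_bounded_bilinear)

interpretation form: bounded_bilinear form
  by (rule bounded_bilinear_form)

lemmas form_simps = form.add_left form.add_right form.diff_left form.diff_right
  form.minus_left form.minus_right form.zero_left form.zero_right form.scaleR_left form.scaleR_right

lemma form_commute: "form x y = form y x"
  by (simp add: form_def mult.commute)

text \<open>The Gram matrix of the form, as a map. Through it determinants and orthogonality for the
  form reduce to the Euclidean inner product.\<close>

definition flip_neg :: "('p::finite, 'q::finite) vec_pq \<Rightarrow> ('p, 'q) vec_pq" where
  "flip_neg x = (\<chi> i. case i of Inl _ \<Rightarrow> x $ i | Inr _ \<Rightarrow> - x $ i)"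

lemma sum_UNIV_Plus:
  fixes f :: "'a::finite + 'b::finite \<Rightarrow> 'c::comm_monoid_add"
  shows "sum f UNIV = (\<Sum>i\<in>UNIV. f (Inl i)) + (\<Sum>j\<in>UNIV. f (Inr j))"
  unfolding UNIV_sum by (subst sum.union_disjoint) (auto simp: sum.reindex)

lemma form_eq_inner: "form x y = x \<bullet> flip_neg y"
  by (simp add: form_def inner_vec_def sum_UNIV_Plus flip_neg_def sum_negf)

lemma flip_neg_flip_neg [simp]: "flip_neg (flip_neg x) = x"
  by (simp add: flip_neg_def vec_eq_iff split: sum.split)

lemma form_nondegenerate:
  assumes "\<And>y. form x y = 0"
  shows "x = 0"
  using assms[of "flip_neg x"] by (simp add: form_eq_inner)

lemma form_nondegenerate_eq:
  assumes "\<And>y. form x y = form x' y"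
  shows "x = x'"
  using form_nondegenerate[of "x - x'"] assms by (simp add: form_simps)

lemma form_self_nonneg:
  assumes "\<And>j. x $ Inr j = 0"
  shows "0 \<le> form x x" and "form x x = 0 \<Longrightarrow> x = 0"
proof -
  have *: "form x x = x \<bullet> x"
    using assms by (simp add: form_def inner_vec_def sum_UNIV_Plus)
  then show "0 \<le> form x x" "form x x = 0 \<Longrightarrow> x = 0"
    by simp_all
qed

text \<open>A negative definite subspace of maximal dimension is the graph of a map from the
  negative to the positive coordinates; \<open>L\<close> parametrizes this graph.\<close>

definition is_graph_map :: "(real ^ 'q \<Rightarrow> ('p::finite, 'q::finite) vec_pq) \<Rightarrow> bool" where
  "is_graph_map L \<longleftrightarrow> linear L \<and> (\<forall>c j. L c $ Inr j = c $ j) \<and> (\<forall>c. c \<noteq> 0 \<longrightarrow> form (L c) (L c) < 0)"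

text \<open>Forgetting the positive coordinates is injective on \<open>\<sigma>\<close>, since a
  vector without negative coordinates has nonnegative square. By the dimension count it is
  bijective, and \<open>L\<close> is its inverse.\<close>

lemma XG_graph_map:
  fixes \<sigma> :: "('p::finite, 'q::finite) vec_pq set"
  assumes "\<sigma> \<in> XG"
  obtains L where "is_graph_map L" "range L = \<sigma>"
proof -
  have sub: "subspace \<sigma>" and dim: "dim \<sigma> = CARD('q)" and neg: "\<And>x. x \<in> \<sigma> \<Longrightarrow> x \<noteq> 0 \<Longrightarrow> form x x < 0"
    using assms by (auto simp: XG_def)
  define pr :: "('p,'q) vec_pq \<Rightarrow> real ^ 'q" where "pr = (\<lambda>x. \<chi> j. x $ Inr j)"
  have lin: "linear pr"
    by (auto intro!: linearI simp: pr_def vec_eq_iff)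
  have inj: "inj_on pr \<sigma>"
    unfolding linear_injective_on_subspace_0[OF lin sub]
  proof (intro ballI impI)
    fix x assume x: "x \<in> \<sigma>" "pr x = 0"
    then have "\<And>j. x $ Inr j = 0"
      by (simp add: pr_def vec_eq_iff)
    from form_self_nonneg(1)[of x, OF this] show "x = 0"
      using neg[OF x(1)] by force
  qed
  obtain L where L: "range L \<subseteq> \<sigma>" "linear L" "\<And>x. x \<in> \<sigma> \<Longrightarrow> L (pr x) = x"
    using linear_exists_left_inverse_on[OF lin sub inj] by auto
  have "span (pr ` \<sigma>) = UNIV"
    using dim_image_eq[OF lin, of \<sigma>] inj dim sub
    by (metis DIM_cart DIM_real dim_eq_full mult.right_neutral span_eq_iff)
  then have surj: "pr ` \<sigma> = UNIV"
    using lin sub by (metis linear_subspace_image span_eq_iff)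
  have pr: "pr (L c) = c" for c
    using surj L(3) by (metis UNIV_I imageE)
  have "is_graph_map L"
    unfolding is_graph_map_def
  proof (intro conjI allI impI)
    show "L c $ Inr j = c $ j" for c j
      using pr[of c] by (metis pr_def vec_lambda_beta)
    fix c :: "real ^ 'q" assume "c \<noteq> 0"
    then have "L c \<noteq> 0"
      using pr[of c] linear_0[OF lin] by metis
    then show "form (L c) (L c) < 0"
      using neg L(1) by blast
  qed (fact L(2))
  moreover have "range L = \<sigma>"
    using L by (metis imageI subsetI subset_antisym UNIV_I)
  ultimately show ?thesis by (rule that)
qed

lemma graph_map_XG:
  fixes L :: "real ^ 'q \<Rightarrow> ('p::finite, 'q::finite) vec_pq"
  assumes "is_graph_map L"
  shows "range L \<in> XG"
proof -
  have lin: "linear L" and neg: "\<And>c. c \<noteq> 0 \<Longrightarrow> form (L c) (L c) < 0"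
    using assms by (auto simp: is_graph_map_def)
  have inj: "inj L"
    unfolding linear_injective_0[OF lin] using neg by (metis form.zero_left less_irrefl)
  have "dim (range L) = dim (UNIV :: (real ^ 'q) set)"
    using inj lin by (simp add: dim_image_eq)
  then have "dim (range L) = CARD('q)"
    by (simp add: dim_UNIV)
  moreover have "subspace (range L)"
    using lin by (simp add: linear_subspace_image)
  moreover have "form x x < 0" if "x \<in> range L" "x \<noteq> 0" for x
    using that neg linear_0[OF lin] by (metis imageE)
  ultimately show ?thesis by (simp add: XG_def)
qed

lemma graph_map_expand:
  assumes "linear L"
  shows "L c = (\<Sum>k\<in>UNIV. c $ k *\<^sub>R L (axis k 1))"
proof -
  have "c = (\<Sum>k\<in>UNIV. c $ k *\<^sub>R axis k 1)"
    by (simp add: basis_expansion scalar_mult_eq_scaleR[symmetric])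
  then have "L c = L (\<Sum>k\<in>UNIV. c $ k *\<^sub>R axis k 1)"
    by simp
  then show ?thesis
    by (simp add: linear_sum[OF assms] linear_scale[OF assms])
qed

text \<open>Two graph maps differ by a vector without negative coordinates, so
  \<open>form ?y ?y\<close> is nonnegative and enters with the favourable sign. Straight
  interpolation therefore never leaves \<open>XG\<close>.\<close>

lemma graph_map_convex:
  fixes L0 L1 :: "real ^ 'q \<Rightarrow> ('p::finite, 'q::finite) vec_pq"
  assumes "is_graph_map L0" "is_graph_map L1" "s \<in> {0..1}"
  shows "is_graph_map (\<lambda>c. (1 - s) *\<^sub>R L0 c + s *\<^sub>R L1 c)"
  unfolding is_graph_map_def
proof (intro conjI allI impI)
  show "linear (\<lambda>c. (1 - s) *\<^sub>R L0 c + s *\<^sub>R L1 c)"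
    using assms by (auto simp: is_graph_map_def intro!: linear_compose_add linear_compose_scale_right)
  show "((1 - s) *\<^sub>R L0 c + s *\<^sub>R L1 c) $ Inr j = c $ j" for c j
    using assms by (auto simp: is_graph_map_def algebra_simps)
  fix c :: "real ^ 'q" assume c: "c \<noteq> 0"
  let ?x = "(1 - s) *\<^sub>R L0 c + s *\<^sub>R L1 c" and ?y = "L0 c - L1 c"
  have "form ?x ?x = (1 - s) * form (L0 c) (L0 c) + s * form (L1 c) (L1 c) - s * (1 - s) * form ?y ?y"
    by (simp add: form_simps form_commute[of "L1 c" "L0 c"] algebra_simps)
  moreover have "0 \<le> form ?y ?y"
    using assms by (intro form_self_nonneg(1)) (auto simp: is_graph_map_def)
  then have "0 \<le> s * (1 - s) * form ?y ?y"
    using assms(3) by simp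
  moreover have "(1 - s) * form (L0 c) (L0 c) + s * form (L1 c) (L1 c) < 0"
    using c assms by (intro convex_bound_lt[of _ 0 _ "1 - s" s, simplified]) (auto simp: is_graph_map_def)
  ultimately show "form ?x ?x < 0" by linarith
qed

section \<open>Form-orthogonal projections\<close>

definition gram :: "(real ^ 'q \<Rightarrow> ('p::finite, 'q::finite) vec_pq) \<Rightarrow> real ^ 'q ^ 'q" where
  "gram L = (\<chi> i j. form (L (axis i 1)) (L (axis j 1)))"

text \<open>The numerators in Cramer's rule for the coordinates of the projection of \<open>x\<close>.\<close>

definition gram_replace ::
  "(real ^ 'q \<Rightarrow> ('p::finite, 'q::finite) vec_pq) \<Rightarrow> ('p, 'q) vec_pq \<Rightarrow> 'q \<Rightarrow> real ^ 'q ^ 'q" where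
  "gram_replace L x k = (\<chi> i j. if j = k then form (L (axis i 1)) x else gram L $ i $ j)"

lemma gram_mult:
  assumes "linear L"
  shows "(gram L *v c) $ i = form (L (axis i 1)) (L c)"
  by (subst (2) graph_map_expand[OF assms])
    (simp add: gram_def matrix_vector_mult_def form.sum_right form_simps mult.commute)

text \<open>A kernel vector \<open>c\<close> would make \<open>L c\<close> orthogonal to the whole
  range, itself included.\<close>

lemma det_gram_nonzero:
  assumes "is_graph_map L"
  shows "det (gram L) \<noteq> 0"
proof -
  have lin: "linear L" and neg: "\<And>c. c \<noteq> 0 \<Longrightarrow> form (L c) (L c) < 0"
    using assms by (auto simp: is_graph_map_def)
  have "c = 0" if "gram L *v c = 0" for c
  proof (rule ccontr)
    assume "c \<noteq> 0"
    have "form (L c) (L c) = (\<Sum>k\<in>UNIV. c $ k * form (L (axis k 1)) (L c))"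
      by (subst graph_map_expand[OF lin]) (simp add: form.sum_left form_simps)
    also have "\<dots> = 0"
      using that by (simp add: gram_mult[OF lin, symmetric])
    finally show False using neg[OF \<open>c \<noteq> 0\<close>] by simp
  qed
  then have "invertible (gram L)"
    by (metis invertible_left_inverse matrix_left_invertible_ker)
  then show ?thesis by (simp add: invertible_det_nz)
qed

lemma projection_unique:
  assumes "\<sigma> \<in> XG" "u \<in> \<sigma>" "x - u \<in> form_perp \<sigma>" "u' \<in> \<sigma>" "x - u' \<in> form_perp \<sigma>"
  shows "u = u'"
proof (rule ccontr)
  assume "u \<noteq> u'"
  have mem: "u - u' \<in> \<sigma>"
    using assms by (simp add: XG_def subspace_diff)
  have "form (u - u') (u - u') = form (x - u') (u - u') - form (x - u) (u - u')"
    by (simp add: form_simps)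
  also have "\<dots> = 0"
    using assms mem by (auto simp: form_perp_def)
  finally show False
    using assms(1) mem \<open>u \<noteq> u'\<close> by (force simp: XG_def)
qed

lemma form_proj_unique:
  assumes "\<sigma> \<in> XG" "u \<in> \<sigma>" "x - u \<in> form_perp \<sigma>"
  shows "form_proj \<sigma> x = u"
  unfolding form_proj_def using assms projection_unique by blast

text \<open>The normal equations of the projection, solved by Cramer's rule. Besides existence this
  gives a formula rational in \<open>L\<close>, which later yields differentiable paths.\<close>

lemma cramer_perp:
  assumes "is_graph_map L"
  shows "x - L (\<chi> k. det (gram_replace L x k) / det (gram L)) \<in> form_perp (range L)"
proof -
  have lin: "linear L" using assms by (simp add: is_graph_map_def)
  define c where "c = (\<chi> k. det (gram_replace L x k) / det (gram L))"
  have "gram L *v c = (\<chi> i. form (L (axis i 1)) x)"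
    using cramer[OF det_gram_nonzero[OF assms], of c "\<chi> i. form (L (axis i 1)) x"]
    by (simp add: c_def gram_replace_def cong: if_cong)
  then have "form (L (axis i 1)) (x - L c) = 0" for i
    by (simp add: form_simps gram_mult[OF lin, symmetric])
  then have "form (L e) (x - L c) = 0" for e
    by (subst graph_map_expand[OF lin]) (simp add: form.sum_left form_simps)
  then show ?thesis
    by (auto simp: form_perp_def form_commute c_def)
qed

lemma form_proj_cramer:
  assumes "is_graph_map L"
  shows "form_proj (range L) x = L (\<chi> k. det (gram_replace L x k) / det (gram L))"
  using cramer_perp[OF assms] graph_map_XG[OF assms] by (intro form_proj_unique) auto

lemma form_proj:
  assumes "\<sigma> \<in> XG"
  shows form_proj_in: "form_proj \<sigma> x \<in> \<sigma>"
    and form_proj_perp: "x - form_proj \<sigma> x \<in> form_perp \<sigma>"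
proof -
  obtain L where L: "is_graph_map L" "range L = \<sigma>"
    using XG_graph_map[OF assms] .
  show "form_proj \<sigma> x \<in> \<sigma>" "x - form_proj \<sigma> x \<in> form_perp \<sigma>"
    using cramer_perp[OF L(1), of x] form_proj_cramer[OF L(1), of x] L(2) by auto
qed

section \<open>Matrix products as bounded bilinear maps\<close>

lemma bounded_bilinear_matrix_mult:
  "bounded_bilinear ((**) :: real ^ 'n ^ 'm \<Rightarrow> real ^ 'k ^ 'n \<Rightarrow> real ^ 'k ^ 'm)"
  unfolding bilinear_conv_bounded_bilinear[symmetric] bilinear_def
  by (auto intro!: linearI simp: vec_eq_iff matrix_matrix_mult_def sum.distrib
      sum_distrib_left algebra_simps)

interpretation matmul: bounded_bilinear
  "(**) :: real ^ 'n ^ 'm \<Rightarrow> real ^ 'k ^ 'n \<Rightarrow> real ^ 'k ^ 'm"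
  by (rule bounded_bilinear_matrix_mult)

lemma bounded_bilinear_matrix_vector_mult:
  "bounded_bilinear ((*v) :: real ^ 'n ^ 'm \<Rightarrow> real ^ 'n \<Rightarrow> real ^ 'm)"
  unfolding bilinear_conv_bounded_bilinear[symmetric] bilinear_def
  by (auto intro!: linearI simp: vec_eq_iff matrix_vector_mult_def sum.distrib
      sum_distrib_left algebra_simps)

interpretation matvec: bounded_bilinear
  "(*v) :: real ^ 'n ^ 'm \<Rightarrow> real ^ 'n \<Rightarrow> real ^ 'm"
  by (rule bounded_bilinear_matrix_vector_mult)

lemmas matmul_simps = matmul.add_left matmul.add_right matmul.diff_left matmul.diff_right
  matmul.minus_left matmul.minus_right matmul.scaleR_left matmul.scaleR_right

lemmas matvec_simps = matvec.add_left matvec.add_right matvec.diff_left matvec.diff_right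
  matvec.minus_left matvec.minus_right matvec.scaleR_left matvec.scaleR_right
  matrix_vector_mul_assoc[symmetric]


text \<open>Since \<open>\<sigma>\<close> has full dimension \<open>q\<close>, it contains a point
  \<open>L c\<close> with the same negative coordinates as \<open>x\<close>. So
  \<open>x - L c\<close> has nonnegative square, and orthogonality turns this into
  \<open>form x x \<ge> - form (L c) (L c)\<close>.\<close>

lemma form_perp_posdef:
  assumes "\<sigma> \<in> XG" "x \<in> form_perp \<sigma>" "x \<noteq> 0"
  shows "form x x > 0"
proof -
  obtain L where L: "is_graph_map L" "range L = \<sigma>"
    using XG_graph_map[OF assms(1)] .
  define c where "c = (\<chi> j. x $ Inr j)"
  define z where "z = x - L c"
  have z: "z $ Inr j = 0" for j
    using L by (simp add: z_def c_def is_graph_map_def)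
  have orth: "form x (L c) = 0"
    using assms(2) L by (auto simp: form_perp_def)
  have xx: "form z z = form x x + form (L c) (L c)"
    using orth by (simp add: z_def form_simps form_commute[of "L c" x])
  have lin: "linear L" using L by (simp add: is_graph_map_def)
  show ?thesis
  proof (cases "c = 0")
    case True
    then have "z = x" by (simp add: z_def linear_0[OF lin])
    then show ?thesis
      using form_self_nonneg[of x] z assms(3) by fastforce
  next
    case False
    then have "form (L c) (L c) < 0" using L by (simp add: is_graph_map_def)
    then show ?thesis using form_self_nonneg(1)[of z] z xx by fastforce
  qed
qed

lemma subspace_form_perp: "subspace (form_perp W)"
  by (auto simp: subspace_def form_perp_def form_simps)

lemma XG_subspace: "\<sigma> \<in> XG \<Longrightarrow> subspace \<sigma>"
  by (simp add: XG_def)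

lemma XG_neg: "\<sigma> \<in> XG \<Longrightarrow> x \<in> \<sigma> \<Longrightarrow> x \<noteq> 0 \<Longrightarrow> form x x < 0"
  by (simp add: XG_def)

lemma form_perpD: "x \<in> form_perp W \<Longrightarrow> y \<in> W \<Longrightarrow> form x y = 0"
  by (simp add: form_perp_def)

lemma form_proj_id: "\<sigma> \<in> XG \<Longrightarrow> x \<in> \<sigma> \<Longrightarrow> form_proj \<sigma> x = x"
  by (rule form_proj_unique) (auto simp: form_perp_def form_simps)

lemma form_proj_zero: "\<sigma> \<in> XG \<Longrightarrow> x \<in> form_perp \<sigma> \<Longrightarrow> form_proj \<sigma> x = 0"
  by (rule form_proj_unique) (auto simp: XG_def subspace_0)

lemma linear_form_proj:
  assumes "\<sigma> \<in> XG"
  shows "linear (form_proj \<sigma>)"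
proof (rule linearI)
  show "form_proj \<sigma> (x + y) = form_proj \<sigma> x + form_proj \<sigma> y" for x y
    using form_proj[OF assms] XG_subspace[OF assms]
      subspace_add[OF subspace_form_perp form_proj_perp[OF assms, of x] form_proj_perp[OF assms, of y]]
    by (intro form_proj_unique[OF assms]) (auto simp: subspace_add algebra_simps)
  show "form_proj \<sigma> (c *\<^sub>R x) = c *\<^sub>R form_proj \<sigma> x" for c x
    using form_proj[OF assms] XG_subspace[OF assms]
      subspace_scale[OF subspace_form_perp form_proj_perp[OF assms, of x], of c]
    by (intro form_proj_unique[OF assms]) (auto simp: subspace_scale algebra_simps)
qed

lemma form_proj_selfadjoint:
  assumes "\<sigma> \<in> XG"
  shows "form (form_proj \<sigma> x) y = form x (form_proj \<sigma> y)"
  using form_perpD[OF form_proj_perp[OF assms, of x] form_proj_in[OF assms, of y]]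
    form_perpD[OF form_proj_perp[OF assms, of y] form_proj_in[OF assms, of x]]
  by (simp add: form_simps form_commute)

lemma matrix_apply: "linear f \<Longrightarrow> matrix f *v x = f x" for f :: "real ^ 'n \<Rightarrow> real ^ 'm"
  by (metis linear_matrix_vector_mul_eq matrix_works)

definition proj_mat :: "('p::finite, 'q::finite) vec_pq set \<Rightarrow> ('p, 'q) mat_pq" where
  "proj_mat \<sigma> = matrix (form_proj \<sigma>)"

lemma proj_mat_mult: "\<sigma> \<in> XG \<Longrightarrow> proj_mat \<sigma> *v x = form_proj \<sigma> x"
  by (simp add: proj_mat_def matrix_apply linear_form_proj)

lemma matrix_eqI: "(\<And>x. A *v x = B *v x) \<Longrightarrow> A = (B :: real ^ 'n ^ 'm)"
  by (simp add: matrix_eq)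

lemma matrix_eq_formI: "(\<And>x y. form (A *v x) y = form (B *v x) y) \<Longrightarrow> A = B"
  by (intro matrix_eqI form_nondegenerate_eq)

lemma proj_mat_idem: "\<sigma> \<in> XG \<Longrightarrow> proj_mat \<sigma> ** proj_mat \<sigma> = proj_mat \<sigma>"
  by (rule matrix_eqI)
    (simp add: matrix_vector_mul_assoc[symmetric] proj_mat_mult form_proj_id form_proj_in)

lemma proj_mat_selfadjoint:
  "\<sigma> \<in> XG \<Longrightarrow> form (proj_mat \<sigma> *v x) y = form x (proj_mat \<sigma> *v y)"
  by (simp add: proj_mat_mult form_proj_selfadjoint)

section \<open>The tangent spaces\<close>

text \<open>The inner product is the form twisted by the involution 1 - 2P, which is -1 on
  \<open>\<sigma>\<close> and 1 on its complement.\<close>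

lemma ip_tau_eq:
  assumes "\<sigma> \<in> XG"
  shows "ip_tau \<sigma> x y = form (x - 2 *\<^sub>R form_proj \<sigma> x) y"
  by (simp add: ip_tau_def form_simps form_proj_selfadjoint[OF assms])

lemma so_skew: "X \<in> so \<Longrightarrow> form (X *v x) y = - form x (X *v y)"
  by (simp add: so_def eq_neg_iff_add_eq_0)

text \<open>For \<open>X\<close> skew with respect to the form, symmetry for
  \<open>ip_tau \<sigma>\<close> says that \<open>X\<close> anticommutes with 1 - 2P: it exchanges
  \<open>\<sigma>\<close> and its complement.\<close>

lemma p_space_iff:
  assumes "\<sigma> \<in> XG"
  shows "X \<in> p_space \<sigma> \<longleftrightarrow> X \<in> so \<and> X ** proj_mat \<sigma> + proj_mat \<sigma> ** X = X"
proof -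
  have "ip_tau \<sigma> (X *v x) y = ip_tau \<sigma> x (X *v y) \<longleftrightarrow>
    form ((X ** proj_mat \<sigma> + proj_mat \<sigma> ** X) *v x) y = form (X *v x) y" if X: "X \<in> so" for x y
    using so_skew[OF X, of x y] so_skew[OF X, of "form_proj \<sigma> x" y]
    by (auto simp: ip_tau_eq[OF assms] matvec_simps proj_mat_mult[OF assms] form_simps)
  then have "X \<in> p_space \<sigma> \<longleftrightarrow> X \<in> so \<and>
    (\<forall>x y. form ((X ** proj_mat \<sigma> + proj_mat \<sigma> ** X) *v x) y = form (X *v x) y)"
    by (auto simp: p_space_def)
  then show ?thesis
    using matrix_eq_formI by metis
qed

section \<open>Positivity of the inner product and of the trace form\<close>

lemma ip_tau_posdef:
  assumes "\<sigma> \<in> XG" "x \<noteq> 0"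
  shows "ip_tau \<sigma> x x > 0"
proof -
  let ?a = "form_proj \<sigma> x" and ?b = "x - form_proj \<sigma> x"
  have "?a \<noteq> 0 \<or> ?b \<noteq> 0" using assms(2) by auto
  moreover have "form ?a ?a < 0 \<or> ?a = 0"
    using XG_neg[OF assms(1) form_proj_in[OF assms(1)]] by blast
  moreover have "form ?b ?b > 0 \<or> ?b = 0"
    using form_perp_posdef[OF assms(1) form_proj_perp[OF assms(1)]] by blast
  ultimately show ?thesis
    unfolding ip_tau_def by (auto simp: form_simps)
qed

lemma bilinear_ip_tau:
  assumes "\<sigma> \<in> XG"
  shows "bilinear (ip_tau \<sigma>)"
  unfolding bilinear_def ip_tau_eq[OF assms, abs_def]
  by (auto intro!: linearI simp: form_simps linear_add[OF linear_form_proj[OF assms]]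
      linear_scale[OF linear_form_proj[OF assms]] algebra_simps)

lemma ip_tau_commute:
  assumes "\<sigma> \<in> XG"
  shows "ip_tau \<sigma> x y = ip_tau \<sigma> y x"
  by (simp add: ip_tau_def form_commute)

text \<open>Gram-Schmidt, with the vectors indexed by coordinates so that in the end they form the
  columns of a square matrix.\<close>

lemma orthonormal_family_exists:
  fixes ip :: "real ^ 'n \<Rightarrow> real ^ 'n \<Rightarrow> real" and F :: "'n set"
  assumes bil: "bilinear ip" and sym: "\<And>x y. ip x y = ip y x"
    and pos: "\<And>x. x \<noteq> 0 \<Longrightarrow> ip x x > 0"
  shows "\<exists>e. \<forall>i\<in>F. \<forall>j\<in>F. ip (e i) (e j) = (if i = j then 1 else 0)"
  using finite[of F]
proof (induction F rule: finite_induct)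
  case (insert k F)
  then obtain e where e: "\<And>i j. i \<in> F \<Longrightarrow> j \<in> F \<Longrightarrow> ip (e i) (e j) = (if i = j then 1 else 0)"
    by blast
  have "dim (e ` F) \<le> card F"
    using dim_le_card'[of "e ` F"] card_image_le[of F e] insert by (metis finite_imageI le_trans)
  also have "card F < CARD('n)"
    using insert by (intro psubset_card_mono) auto
  finally have "span (e ` F) \<noteq> UNIV"
    by (metis DIM_cart DIM_real dim_eq_full less_irrefl mult.right_neutral)
  then obtain x where x: "x \<notin> span (e ` F)" by auto
  define y where "y = x - (\<Sum>i\<in>F. ip x (e i) *\<^sub>R e i)"
  have lin: "linear (\<lambda>z. ip z w)" "linear (\<lambda>z. ip w z)" for w
    using bil by (auto simp: bilinear_def)
  have "(\<Sum>i\<in>F. ip x (e i) *\<^sub>R e i) \<in> span (e ` F)"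
    by (intro span_sum span_scale span_base imageI)
  then have "y \<noteq> 0"
    using x by (auto simp: y_def)
  have y_orth: "ip y (e j) = 0" if "j \<in> F" for j
  proof -
    have "ip y (e j) = ip x (e j) - (\<Sum>i\<in>F. ip x (e i) * ip (e i) (e j))"
      by (simp add: y_def linear_diff[OF lin(1)] linear_sum[OF lin(1)] linear_scale[OF lin(1)])
    also have "(\<Sum>i\<in>F. ip x (e i) * ip (e i) (e j)) = (\<Sum>i\<in>F. if i = j then ip x (e i) else 0)"
      using e that by (intro sum.cong) auto
    finally show ?thesis using that insert by simp
  qed
  define u where "u = (1 / sqrt (ip y y)) *\<^sub>R y"
  have u: "ip u u = 1"
    using pos[OF \<open>y \<noteq> 0\<close>]
    by (simp add: u_def linear_scale[OF lin(1)] linear_scale[OF lin(2)] field_simps)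
  have uo: "ip u (e j) = 0" "ip (e j) u = 0" if "j \<in> F" for j
    using y_orth[OF that] sym by (simp_all add: u_def linear_scale[OF lin(1)] linear_scale[OF lin(2)])
  show ?case
    using e u uo insert by (intro exI[of _ "e(k := u)"]) auto
qed simp

text \<open>In an orthonormal basis the trace of \<open>Z ** Z\<close> is the sum of the squared
  lengths of the \<open>Z *v e i\<close>. The inner product is kept general for the sake of
  \<open>ip_tau \<sigma>\<close>.\<close>

lemma trace_square_selfadjoint_nonneg:
  fixes ip :: "real ^ 'n \<Rightarrow> real ^ 'n \<Rightarrow> real"
  assumes bil: "bilinear ip" and sym: "\<And>x y. ip x y = ip y x"
    and pos: "\<And>x. x \<noteq> 0 \<Longrightarrow> ip x x > 0"
    and Z: "\<And>x y. ip (Z *v x) y = ip x (Z *v y)"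
  shows "0 \<le> trace (Z ** Z)"
proof -
  obtain e :: "'n \<Rightarrow> real ^ 'n" where e: "\<And>i j. ip (e i) (e j) = (if i = j then 1 else 0)"
    using orthonormal_family_exists[of ip UNIV, OF bil sym pos] by auto
  have lin: "linear (\<lambda>z. ip w z)" for w
    using bil by (auto simp: bilinear_def)
  \<comment> \<open>\<open>B\<close> has the basis as columns and \<open>C\<close> reads off
    coordinates. Orthonormality makes them mutually inverse, so conjugating by them preserves the
    trace.\<close>
  define B :: "real ^ 'n ^ 'n" where "B = (\<chi> a i. e i $ a)"
  define C :: "real ^ 'n ^ 'n" where "C = matrix (\<lambda>x. \<chi> i. ip (e i) x)"
  have C: "C *v x = (\<chi> i. ip (e i) x)" for x
    unfolding C_def
    by (rule matrix_apply)
      (auto intro!: linearI simp: vec_eq_iff linear_add[OF lin] linear_scale[OF lin])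
  have B: "B *v axis i 1 = e i" for i
    by (simp add: B_def matrix_vector_mul_component vec_eq_iff inner_axis)
  have ax: "(M *v axis i 1) $ j = M $ j $ i" for M :: "real ^ 'n ^ 'n" and i j
    by (simp add: matrix_vector_mul_component inner_axis)
  have entry: "(C ** M ** B) $ i $ i = ip (e i) (M *v e i)" for M i
    by (subst ax[symmetric]) (simp add: matrix_vector_mul_assoc[symmetric] B C)
  have "(C ** B) $ j $ i = mat 1 $ j $ i" for i j
    by (subst ax[symmetric]) (auto simp: matrix_vector_mul_assoc[symmetric] B C e mat_def)
  then have "C ** B = mat 1"
    by (simp add: vec_eq_iff)
  then have BC: "B ** C = mat 1"
    by (simp add: matrix_left_right_inverse)
  have "trace (Z ** Z) = trace (Z ** Z ** B ** C)"
    by (simp add: matrix_mul_assoc[symmetric] BC)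
  also have "\<dots> = trace (C ** (Z ** Z) ** B)"
    by (metis matrix_mul_assoc trace_mul_sym)
  also have "\<dots> = (\<Sum>i\<in>UNIV. ip (e i) ((Z ** Z) *v e i))"
    by (simp add: trace_def entry)
  also have "\<dots> = (\<Sum>i\<in>UNIV. ip (Z *v e i) (Z *v e i))"
    by (simp add: matrix_vector_mul_assoc[symmetric] Z)
  also have "\<dots> \<ge> 0"
    using pos linear_0[OF lin] by (intro sum_nonneg) (metis less_eq_real_def)
  finally show ?thesis .
qed

lemma trace_square_p_space_nonneg:
  assumes "\<sigma> \<in> XG" "X \<in> p_space \<sigma>"
  shows "0 \<le> trace (X ** X)"
  using assms bilinear_ip_tau ip_tau_posdef ip_tau_commute
  by (intro trace_square_selfadjoint_nonneg[of "ip_tau \<sigma>"]) (auto simp: p_space_def)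

text \<open>The Lie algebra element that corresponds to the bivector of \<open>a\<close> and
  \<open>b\<close>. With \<open>a\<close> in \<open>\<sigma>\<close> and \<open>b\<close> in the
  complement it is the tangent vector that turns \<open>a\<close> towards \<open>b\<close>.\<close>

definition wedge :: "('p::finite, 'q::finite) vec_pq \<Rightarrow> ('p, 'q) vec_pq \<Rightarrow> ('p, 'q) mat_pq" where
  "wedge a b = matrix (\<lambda>x. form x b *\<^sub>R a - form x a *\<^sub>R b)"

lemma wedge_mult: "wedge a b *v x = form x b *\<^sub>R a - form x a *\<^sub>R b"
  unfolding wedge_def
  by (rule matrix_apply) (auto intro!: linearI simp: form_simps algebra_simps)

lemma wedge_so: "wedge a b \<in> so"
  by (simp add: so_def wedge_mult form_simps form_commute)

text \<open>For skew \<open>Z\<close> the right-hand side is \<open>2 * form (Z *v a) b\<close>, the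
  quantity that governs the derivative of the gap; so the trace form represents it by
  \<open>wedge a b\<close>.\<close>

lemma trace_mult_wedge:
  fixes Z :: "('p::finite, 'q::finite) mat_pq"
  shows "trace (Z ** wedge a b) = form (Z *v a) b - form (Z *v b) a"
proof -
  have ax: "M $ i $ i = (M *v axis i 1) $ i" for M :: "('p,'q) mat_pq" and i
    by (simp add: matrix_vector_mul_component inner_axis)
  have *: "(\<Sum>i\<in>UNIV. form (axis i 1) c * u $ i) = form u c" for u c :: "('p,'q) vec_pq"
  proof -
    have "u = (\<Sum>i\<in>UNIV. u $ i *\<^sub>R axis i 1)"
      by (simp add: basis_expansion scalar_mult_eq_scaleR[symmetric])
    then have "form u c = (\<Sum>i\<in>UNIV. u $ i * form (axis i 1) c)"
      by (metis (mono_tags, lifting) form.scaleR_left form.sum_left real_scaleR_def sum.cong)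
    then show ?thesis by (simp add: mult.commute)
  qed
  show ?thesis
    unfolding trace_def
    by (subst ax) (simp add: matrix_vector_mul_assoc[symmetric] wedge_mult vec.diff
        matrix_vector_mult_scaleR sum_subtractf *)
qed

lemma wedge_p_space:
  assumes "\<sigma> \<in> XG" "a \<in> \<sigma>" "b \<in> form_perp \<sigma>"
  shows "wedge a b \<in> p_space \<sigma>"
proof -
  have "wedge a b ** proj_mat \<sigma> + proj_mat \<sigma> ** wedge a b = wedge a b"
  proof (rule matrix_eqI)
    fix x
    have "form (form_proj \<sigma> x) b = 0" "form (form_proj \<sigma> x) a = form x a"
      using assms by (simp_all add: form_proj_selfadjoint form_proj_zero form_proj_id form_simps)
    then show "(wedge a b ** proj_mat \<sigma> + proj_mat \<sigma> ** wedge a b) *v x = wedge a b *v x"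
      using assms linear_form_proj[OF assms(1)]
      by (simp add: matvec_simps proj_mat_mult wedge_mult linear_diff linear_scale form_proj_id form_proj_zero form_simps)
  qed
  then show ?thesis
    using p_space_iff[OF assms(1)] wedge_so by blast
qed

text \<open>Cauchy--Schwarz for the trace form on \<open>p_space \<sigma>\<close>, applied to \<open>X\<close> and \<open>wedge a b\<close>.\<close>

lemma p_space_speed_bound:
  assumes "\<sigma> \<in> XG" "X \<in> p_space \<sigma>" "a \<in> \<sigma>" "b \<in> form_perp \<sigma>"
  shows "(form (X *v a) b)\<^sup>2 \<le> trace (X ** X) / 2 * (- form a a * form b b)"
proof -
  have ab: "form a b = 0" "form b a = 0"
    using form_perpD[OF assms(4,3)] by (simp_all add: form_commute)
  have X: "X \<in> so" using assms by (simp add: p_space_def)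
  let ?W = "wedge a b"
  define A where "A = - form a a * form b b"
  define \<beta> where "\<beta> = form (X *v a) b"
  define T where "T = trace (X ** X)"
  have W2: "trace (?W ** ?W) = 2 * A"
    by (simp add: trace_mult_wedge wedge_mult form_simps ab A_def)
  have XW: "trace (X ** ?W) = 2 * \<beta>"
    using so_skew[OF X, of b a] by (simp add: trace_mult_wedge form_commute \<beta>_def)
  have "0 \<le> A"
    using XG_neg[OF assms(1,3)] form_perp_posdef[OF assms(1,4)]
    unfolding A_def by (cases "a = 0"; cases "b = 0") (auto simp: mult_le_0_iff less_imp_le form_simps)
  \<comment> \<open>Cauchy-Schwarz through the discriminant: the trace form is nonnegative along the
    whole line through \<open>X\<close> in the direction \<open>?W\<close>. The coefficient
    \<open>A\<close> may vanish, since \<open>a\<close> or \<open>b\<close> may be zero.\<close>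
  have quad: "0 \<le> T + r * (4 * \<beta>) + r\<^sup>2 * (2 * A)" for r
  proof -
    let ?Z = "X + r *\<^sub>R ?W"
    have scale: "trace (r *\<^sub>R M) = r * trace M" for r and M :: "('a,'b) mat_pq"
      by (simp add: trace_def sum_distrib_left)
    have "ip_tau \<sigma> (?Z *v x) y = ip_tau \<sigma> x (?Z *v y)" for x y
      using assms(2) wedge_p_space[OF assms(1,3,4)] bilinear_ip_tau[OF assms(1)]
      by (simp add: p_space_def matrix_vector_mult_add_rdistrib scaleR_matrix_vector_assoc[symmetric]
          bilinear_ladd bilinear_radd bilinear_lmul bilinear_rmul)
    then have "0 \<le> trace (?Z ** ?Z)"
      using assms bilinear_ip_tau ip_tau_posdef ip_tau_commute
      by (intro trace_square_selfadjoint_nonneg[of "ip_tau \<sigma>"]) auto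
    also have "?Z ** ?Z = X ** X + r *\<^sub>R (X ** ?W) + r *\<^sub>R (?W ** X) + r\<^sup>2 *\<^sub>R (?W ** ?W)"
      by (simp add: matmul_simps power2_eq_square algebra_simps)
    also have "trace \<dots> = T + r * (4 * \<beta>) + r\<^sup>2 * (2 * A)"
      using trace_mul_sym[of ?W X] by (simp add: trace_add scale XW W2 T_def)
    finally show ?thesis .
  qed
  have "\<beta>\<^sup>2 \<le> T / 2 * A"
  proof (cases "A = 0")
    case True
    have "\<beta> = 0"
    proof (rule ccontr)
      assume "\<beta> \<noteq> 0"
      \<comment> \<open>For \<open>A = 0\<close> the polynomial is affine in \<open>r\<close>, and
        this \<open>r\<close> gives it the value -1.\<close>
      with quad[of "- (T + 1) / (4 * \<beta>)"] True show False
        by (simp add: field_simps)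
    qed
    then show ?thesis using True by simp
  next
    case False
    then have "A > 0" using \<open>0 \<le> A\<close> by simp
    \<comment> \<open>\<open>- \<beta> / A\<close> minimizes the polynomial; the factor
      \<open>A\<close> clears the denominator.\<close>
    have "0 \<le> A * (T + (- \<beta> / A) * (4 * \<beta>) + (- \<beta> / A)\<^sup>2 * (2 * A))"
      using quad[of "- \<beta> / A"] \<open>A > 0\<close> by (intro mult_nonneg_nonneg) auto
    also have "\<dots> = A * T - 2 * \<beta>\<^sup>2"
      using \<open>A > 0\<close> by (simp add: field_simps power2_eq_square)
    finally show ?thesis by (simp add: mult.commute)
  qed
  then show ?thesis by (simp add: A_def \<beta>_def T_def)
qed

section \<open>Isometries of the form\<close>

text \<open>The full orthogonal group of the form. The determinant is kept apart because the
  building blocks below are reflections, of determinant -1.\<close>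

definition isometry :: "('p::finite, 'q::finite) mat_pq \<Rightarrow> bool" where
  "isometry A \<longleftrightarrow> (\<forall>x y. form (A *v x) (A *v y) = form x y)"

lemma isometryD: "isometry A \<Longrightarrow> form (A *v x) (A *v y) = form x y"
  by (simp add: isometry_def)

lemma SO_iff: "A \<in> SO \<longleftrightarrow> det A = 1 \<and> isometry A"
  by (simp add: SO_def SL_def isometry_def)

lemma isometry_mult: "isometry A \<Longrightarrow> isometry B \<Longrightarrow> isometry (A ** B)"
  by (simp add: isometry_def matvec_simps)

lemma isometry_one [simp]: "isometry (mat 1)"
  by (simp add: isometry_def)

lemma isometry_inj:
  assumes "isometry A" "A *v x = 0"
  shows "x = 0"
  using assms isometryD[OF assms(1), of x] by (intro form_nondegenerate) (metis form.zero_left)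

lemma isometry_invertible: "isometry A \<Longrightarrow> invertible A"
  by (metis invertible_left_inverse isometry_inj matrix_left_invertible_ker)

lemma matrix_inv_mult:
  assumes "invertible A"
  shows "A ** matrix_inv A = mat 1" "matrix_inv A ** A = mat 1"
  using assms someI_ex[of "\<lambda>A'. A ** A' = mat 1 \<and> A' ** A = mat 1"]
  by (simp_all add: invertible_def matrix_inv_def)

lemma isometry_inv:
  assumes "isometry A"
  shows "isometry (matrix_inv A)"
  unfolding isometry_def
proof (intro allI)
  fix x y
  have *: "A *v (matrix_inv A *v z) = z" for z
    by (simp add: matrix_vector_mul_assoc matrix_inv_mult[OF isometry_invertible[OF assms]])
  show "form (matrix_inv A *v x) (matrix_inv A *v y) = form x y"
    using isometryD[OF assms, of "matrix_inv A *v x" "matrix_inv A *v y"] by (simp add: *)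
qed

lemma isometry_inverse_mult:
  assumes "isometry A"
  shows "A *v (matrix_inv A *v x) = x" "matrix_inv A *v (A *v x) = x"
  by (simp_all add: matrix_vector_mul_assoc matrix_inv_mult[OF isometry_invertible[OF assms]])

text \<open>With \<open>F\<close> the Gram matrix of the form, being an isometry means
  \<open>transpose A ** F ** A = F\<close>. Take determinants, knowing that
  \<open>F ** F = mat 1\<close>.\<close>

lemma isometry_det:
  assumes "isometry A"
  shows "det A = 1 \<or> det A = -1"
proof -
  define F :: "('a, 'b) mat_pq" where "F = matrix flip_neg"
  have F: "F *v x = flip_neg x" for x
    unfolding F_def
    by (rule matrix_apply) (auto intro!: linearI simp: flip_neg_def vec_eq_iff split: sum.split)
  have adj: "x \<bullet> (w v* A) = (A *v x) \<bullet> w" for x w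
    by (metis dot_lmul_matrix inner_commute)
  have "x \<bullet> ((transpose A ** F ** A) *v y) = x \<bullet> (F *v y)" for x y
    using isometryD[OF assms, of x y]
    by (simp add: form_eq_inner matvec_simps F adj)
  then have "transpose A ** F ** A = F"
    by (intro matrix_eqI) (metis vector_eq_ldot)
  then have "det A * det F * det A = det F"
    by (metis det_mul det_transpose)
  moreover have "F ** F = mat 1"
    by (rule matrix_eqI) (simp add: matvec_simps F)
  then have "det F * det F = 1"
    by (metis det_I det_mul)
  ultimately have "det A * det A = 1"
    by (metis mult.assoc mult.commute mult.right_neutral)
  then show ?thesis
    by (simp add: square_eq_1_iff)
qed

lemma isometry_image_XG:
  assumes "isometry A" "\<sigma> \<in> XG"
  shows "(*v) A ` \<sigma> \<in> XG"
proof -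
  have "inj ((*v) A)"
    using isometry_inj[OF assms(1)] by (simp add: linear_injective_0)
  then have "dim ((*v) A ` \<sigma>) = dim \<sigma>"
    by (intro dim_image_eq) (auto intro: inj_on_subset)
  moreover have "form (A *v x) (A *v x) < 0" if "x \<in> \<sigma>" "A *v x \<noteq> 0" for x
    using that assms isometryD[OF assms(1), of x x] by (auto simp: XG_def)
  ultimately show ?thesis
    using assms(2) by (auto simp: XG_def linear_subspace_image)
qed

lemma isometry_form_proj:
  assumes "isometry A" "\<sigma> \<in> XG"
  shows "form_proj ((*v) A ` \<sigma>) (A *v x) = A *v form_proj \<sigma> x"
proof (rule form_proj_unique[OF isometry_image_XG[OF assms]])
  show "A *v form_proj \<sigma> x \<in> (*v) A ` \<sigma>"
    using form_proj_in[OF assms(2)] by blast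
  show "A *v x - A *v form_proj \<sigma> x \<in> form_perp ((*v) A ` \<sigma>)"
    using form_proj_perp[OF assms(2), of x] assms(1)
    by (auto simp: form_perp_def isometry_def simp flip: matvec.diff_right)
qed

lemma isometry_proj_mat:
  assumes "isometry A" "\<sigma> \<in> XG"
  shows "proj_mat ((*v) A ` \<sigma>) = A ** proj_mat \<sigma> ** matrix_inv A"
proof (rule matrix_eqI)
  fix x
  show "proj_mat ((*v) A ` \<sigma>) *v x = (A ** proj_mat \<sigma> ** matrix_inv A) *v x"
    using isometry_form_proj[OF assms, of "matrix_inv A *v x"] isometry_image_XG[OF assms] assms
    by (simp add: matvec_simps proj_mat_mult isometry_inverse_mult)
qed

lemma isometry_conj_so:
  assumes "isometry A" "X \<in> so"
  shows "A ** X ** matrix_inv A \<in> so"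
proof -
  have "form (A *v (X *v (matrix_inv A *v x))) y = form (X *v (matrix_inv A *v x)) (matrix_inv A *v y)" for x y
    using isometryD[OF assms(1), of _ "matrix_inv A *v y"] by (simp add: isometry_inverse_mult[OF assms(1)])
  moreover have "form x (A *v (X *v (matrix_inv A *v y))) = form (matrix_inv A *v x) (X *v (matrix_inv A *v y))" for x y
    using isometryD[OF assms(1), of "matrix_inv A *v x"] by (simp add: isometry_inverse_mult[OF assms(1)])
  ultimately show ?thesis
    using assms(2) by (simp add: so_def matvec_simps)
qed

lemma isometry_conj_p_space:
  assumes "isometry A" "\<sigma> \<in> XG" "X \<in> p_space \<sigma>"
  shows "A ** X ** matrix_inv A \<in> p_space ((*v) A ` \<sigma>)"
proof -
  have X: "X \<in> so" "X ** proj_mat \<sigma> + proj_mat \<sigma> ** X = X"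
    using assms(3) p_space_iff[OF assms(2)] by auto
  have cancel: "M ** matrix_inv A ** A ** N = M ** N" for M N
    by (metis matrix_inv_mult(2)[OF isometry_invertible[OF assms(1)]] matrix_mul_assoc matrix_mul_rid)
  have "A ** X ** matrix_inv A ** (A ** proj_mat \<sigma> ** matrix_inv A)
      + A ** proj_mat \<sigma> ** matrix_inv A ** (A ** X ** matrix_inv A)
      = A ** (X ** proj_mat \<sigma> + proj_mat \<sigma> ** X) ** matrix_inv A"
    by (simp add: matmul_simps matrix_mul_assoc cancel)
  then show ?thesis
    using isometry_conj_so[OF assms(1) X(1)] X(2)
    by (simp add: p_space_iff[OF isometry_image_XG[OF assms(1,2)]] isometry_proj_mat[OF assms(1,2)])
qed

lemma trace_conj:
  fixes A X :: "real ^ 'n ^ 'n"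
  assumes "invertible A"
  shows "trace (A ** X ** matrix_inv A) = trace X"
  by (metis assms matrix_inv_mult(2) matrix_mul_assoc matrix_mul_lid trace_mul_sym)

section \<open>The matrix exponential\<close>

definition matpow :: "real ^ 'n ^ 'n \<Rightarrow> nat \<Rightarrow> real ^ 'n ^ 'n" where
  "matpow X n = (((**) X) ^^ n) (mat 1)"

lemma matpow_0 [simp]: "matpow X 0 = mat 1"
  by (simp add: matpow_def)

lemma matpow_Suc: "matpow X (Suc n) = X ** matpow X n"
  by (simp add: matpow_def)

lemma matpow_commute: "X ** matpow X n = matpow X n ** X"
  by (induction n) (simp_all add: matpow_Suc matrix_mul_assoc)

lemma matpow_scaleR: "matpow (s *\<^sub>R X) n = s ^ n *\<^sub>R matpow X n"
  by (induction n) (simp_all add: matpow_Suc matmul_simps)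

lemma mexp_eq: "mexp X = (\<Sum>n. (1 / fact n) *\<^sub>R matpow X n)"
  by (simp add: mexp_def matpow_def)

lemma mexp_summable_norm:
  fixes X :: "real ^ 'n ^ 'n"
  shows "summable (\<lambda>n. norm ((1 / fact n) *\<^sub>R matpow X n))"
proof -
  obtain K where K: "K > 0"
    "\<And>(A :: real ^ 'n ^ 'n) (B :: real ^ 'n ^ 'n). norm (A ** B) \<le> norm A * norm B * K"
    using matmul.pos_bounded by blast
  define M where "M = norm (mat 1 :: real ^ 'n ^ 'n)"
  have bound: "norm (matpow X n) \<le> M * (norm X * K) ^ n" for n
  proof (induction n)
    case (Suc n)
    have "norm (matpow X (Suc n)) \<le> norm X * norm (matpow X n) * K"
      using K(2)[of X "matpow X n"] by (simp only: matpow_Suc)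
    also have "\<dots> \<le> norm X * (M * (norm X * K) ^ n) * K"
      using Suc K(1) by (intro mult_right_mono mult_left_mono) auto
    finally show ?case by (simp add: mult_ac)
  qed (simp add: M_def)
  have "summable (\<lambda>n. M * (inverse (fact n) * (norm X * K) ^ n))"
    by (intro summable_mult summable_exp)
  then show ?thesis
  proof (rule summable_comparison_test[rotated], intro exI allI impI)
    fix n
    show "norm (norm ((1 / fact n) *\<^sub>R matpow X n)) \<le> M * (inverse (fact n) * (norm X * K) ^ n)"
      using bound[of n] by (simp add: field_simps)
  qed
qed

lemmas mexp_summable = summable_norm_cancel[OF mexp_summable_norm]

lemma mexp_commute: "X ** mexp X = mexp X ** X"
proof -
  have "X ** mexp X = (\<Sum>n. X ** ((1 / fact n) *\<^sub>R matpow X n))"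
    unfolding mexp_eq
    by (rule bounded_linear.suminf[OF matmul.bounded_linear_right mexp_summable])
  also have "\<dots> = (\<Sum>n. ((1 / fact n) *\<^sub>R matpow X n) ** X)"
    by (simp add: matmul_simps matpow_commute)
  also have "\<dots> = mexp X ** X"
    unfolding mexp_eq
    by (rule bounded_linear.suminf[OF matmul.bounded_linear_left mexp_summable, symmetric])
  finally show ?thesis .
qed

lemma mexp_0 [simp]: "mexp (0 :: real ^ 'n ^ 'n) = mat 1"
proof -
  have "matpow (0 :: real ^ 'n ^ 'n) n = 0" if "n \<noteq> 0" for n
    using that by (cases n) (simp_all add: matpow_Suc matmul.zero_left)
  then have "mexp (0 :: real ^ 'n ^ 'n) = (\<Sum>n\<in>{0}. (1 / fact n) *\<^sub>R matpow 0 n)"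
    unfolding mexp_eq by (intro suminf_finite) auto
  then show ?thesis by simp
qed

lemma has_vector_derivative_matrixI:
  fixes f :: "real \<Rightarrow> real ^ 'n ^ 'm"
  assumes "\<And>i j. ((\<lambda>s. f s $ i $ j) has_real_derivative f' $ i $ j) (at s within S)"
  shows "(f has_vector_derivative f') (at s within S)"
  unfolding has_vector_derivative_def
proof (subst has_derivative_componentwise_within, intro ballI)
  fix b :: "real ^ 'n ^ 'm" assume "b \<in> Basis"
  then obtain i j where b: "b = axis i (axis j 1)"
    by (auto simp: Basis_vec_def)
  show "((\<lambda>x. f x \<bullet> b) has_derivative (\<lambda>x. x *\<^sub>R f' \<bullet> b)) (at s within S)"
    using assms[of i j] by (simp add: b inner_axis has_field_derivative_def mult.commute[of _ "f' $ i $ j"])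
qed

text \<open>Each entry is an everywhere convergent power series in \<open>s\<close>, so it may be
  differentiated term by term.\<close>

lemma mexp_deriv:
  fixes X :: "real ^ 'n ^ 'n"
  shows
  "((\<lambda>s. mexp (s *\<^sub>R X)) has_vector_derivative X ** mexp (s *\<^sub>R X)) (at s)"
proof (rule has_vector_derivative_matrixI)
  fix i j
  have entry: "bounded_linear (\<lambda>A :: real ^ 'n ^ 'n. A $ i $ j)"
    by (intro bounded_linear_compose[OF bounded_linear_vec_nth] bounded_linear_vec_nth)
  define c where "c n = matpow X n $ i $ j / fact n" for n
  have sums: "(\<lambda>n. c n * s ^ n) sums (mexp (s *\<^sub>R X) $ i $ j)" for s
    using bounded_linear.sums[OF entry summable_sums[OF mexp_summable[of "s *\<^sub>R X"]]]
    by (simp add: mexp_eq c_def matpow_scaleR mult_ac)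
  have "(\<lambda>n. diffs c n * s ^ n) sums ((X ** mexp (s *\<^sub>R X)) $ i $ j)"
  proof -
    have "(\<lambda>n. (X ** ((1 / fact n) *\<^sub>R matpow (s *\<^sub>R X) n)) $ i $ j) sums ((X ** mexp (s *\<^sub>R X)) $ i $ j)"
      unfolding mexp_eq
      by (intro bounded_linear.sums[OF entry] bounded_linear.sums[OF matmul.bounded_linear_right]
          summable_sums mexp_summable)
    moreover have "(X ** ((1 / fact n) *\<^sub>R matpow (s *\<^sub>R X) n)) $ i $ j = diffs c n * s ^ n" for n
      by (simp add: matmul_simps matpow_scaleR matpow_Suc diffs_def c_def fact_Suc field_simps
          del: of_nat_Suc)
    ultimately show ?thesis by simp
  qed
  then show "((\<lambda>s. mexp (s *\<^sub>R X) $ i $ j) has_real_derivative (X ** mexp (s *\<^sub>R X)) $ i $ j) (at s)"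
    using termdiffs_strong_converges_everywhere[of c s] sums by (simp add: sums_iff)
qed

lemma mexp_scaleR_commute: "X ** mexp (s *\<^sub>R X) = mexp (s *\<^sub>R X) ** X"
proof (cases "s = 0")
  case False
  then have "s *\<^sub>R (X ** mexp (s *\<^sub>R X)) = s *\<^sub>R (mexp (s *\<^sub>R X) ** X)"
    using mexp_commute[of "s *\<^sub>R X"] by (simp add: matmul_simps)
  with False show ?thesis by simp
qed simp

text \<open>The inverse, uniqueness, isometry and doubling statements below all come from this: a
  suitable product has derivative zero, and two of its values are compared.\<close>

lemma constant_if_derivative_zero:
  fixes f :: "real \<Rightarrow> 'a::real_normed_vector"
  assumes "\<And>s. (f has_vector_derivative 0) (at s)"
  shows "f s = f t"
  using has_derivative_zero_constant[of UNIV f] assms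
  by (auto simp: has_vector_derivative_def)

text \<open>The affine time change covers inverse flows, the doubling argument and curves run from
  time -1 to time 0.\<close>

lemma mexp_deriv_shift:
  "((\<lambda>s. mexp ((a * s + t) *\<^sub>R X)) has_vector_derivative (a *\<^sub>R (X ** mexp ((a * s + t) *\<^sub>R X)))) (at s)"
proof -
  have "((\<lambda>s. a * s + t) has_vector_derivative a) (at s)"
    by (auto intro!: derivative_eq_intros)
  from vector_diff_chain_at[OF this mexp_deriv] show ?thesis
    by (simp add: o_def)
qed

lemma mexp_deriv_neg:
  "((\<lambda>s. mexp (- (s *\<^sub>R X))) has_vector_derivative - (X ** mexp (- (s *\<^sub>R X)))) (at s)"
  using mexp_deriv_shift[of "-1" 0 X s] by simp

lemma mexp_neg_scaleR_commute: "X ** mexp (- (s *\<^sub>R X)) = mexp (- (s *\<^sub>R X)) ** X"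
  using mexp_scaleR_commute[of X "- s"] by simp

lemma mexp_neg_right: "mexp X ** mexp (- X) = mat 1"
proof -
  have "((\<lambda>s. mexp (s *\<^sub>R X) ** mexp (- (s *\<^sub>R X))) has_vector_derivative 0) (at s)" for s
    using bounded_bilinear.has_vector_derivative[OF bounded_bilinear_matrix_mult mexp_deriv[of X s] mexp_deriv_neg[of X s]]
    by (simp add: matmul_simps matrix_mul_assoc mexp_scaleR_commute)
  from constant_if_derivative_zero[OF this, of 1 0] show ?thesis by simp
qed

lemma mexp_neg_left: "mexp (- X) ** mexp X = mat 1"
  using mexp_neg_right[of "- X"] by simp

lemma matrix_inv_unique:
  fixes A B :: "real ^ 'n ^ 'n"
  assumes "A ** B = mat 1"
  shows "matrix_inv A = B"
proof -
  have "B ** A = mat 1" using assms by (simp add: matrix_left_right_inverse)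
  then have "invertible A" using assms by (auto simp: invertible_def)
  then show ?thesis
    by (metis \<open>B ** A = mat 1\<close> matrix_inv_mult(1) matrix_mul_assoc matrix_mul_lid matrix_mul_rid)
qed

lemma mexp_inv: "matrix_inv (mexp X) = mexp (- X)"
  by (rule matrix_inv_unique[OF mexp_neg_right])

text \<open>The inverse flow applied to \<open>y s\<close> is constant. This evaluates exponentials
  through explicit solutions of the linear equation.\<close>

lemma mexp_unique:
  fixes y :: "real \<Rightarrow> real ^ 'n"
  assumes "\<And>s. (y has_vector_derivative X *v y s) (at s)"
  shows "y s = mexp (s *\<^sub>R X) *v y 0"
proof -
  have "((\<lambda>s. mexp (- (s *\<^sub>R X)) *v y s) has_vector_derivative 0) (at s)" for s
    using bounded_bilinear.has_vector_derivative[OF bounded_bilinear_matrix_vector_mult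
        mexp_deriv_neg[of X s] assms[of s]]
    by (simp only: matrix_vector_mul_assoc matvec.minus_left mexp_neg_scaleR_commute add.right_inverse)
  from constant_if_derivative_zero[OF this, of s 0]
  have "mexp (s *\<^sub>R X) *v (mexp (- (s *\<^sub>R X)) *v y s) = mexp (s *\<^sub>R X) *v y 0"
    by simp
  then show ?thesis
    by (simp add: matrix_vector_mul_assoc mexp_neg_right)
qed

lemma mexp_isometry:
  assumes "X \<in> so"
  shows "isometry (mexp X)"
  unfolding isometry_def
proof (intro allI)
  fix x y
  have D: "((\<lambda>s. mexp (s *\<^sub>R X) *v z) has_vector_derivative X *v (mexp (s *\<^sub>R X) *v z)) (at s)" for z s
    using bounded_linear.has_vector_derivative[OF matvec.bounded_linear_left[of z] mexp_deriv[of X s]]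
    by (simp add: matvec_simps)
  have "((\<lambda>s. form (mexp (s *\<^sub>R X) *v x) (mexp (s *\<^sub>R X) *v y)) has_vector_derivative 0) (at s)" for s
    using bounded_bilinear.has_vector_derivative[OF bounded_bilinear_form D[of x s] D[of y s]] assms
    by (simp add: so_skew)
  from constant_if_derivative_zero[OF this, of 1 0]
  show "form (mexp X *v x) (mexp X *v y) = form x y" by simp
qed

lemma mexp_double: "mexp (2 *\<^sub>R X) = mexp X ** mexp X"
proof -
  have "((\<lambda>t. mexp ((1 * t + 1) *\<^sub>R X) ** mexp (- (t *\<^sub>R X))) has_vector_derivative 0) (at t)" for t
    using bounded_bilinear.has_vector_derivative[OF bounded_bilinear_matrix_mult
        mexp_deriv_shift[of 1 1 X t] mexp_deriv_neg[of X t]]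
      mexp_scaleR_commute[of X "1 * t + 1"]
    by (simp only: matmul_simps matrix_mul_assoc scaleR_one add.left_inverse)
  from constant_if_derivative_zero[OF this, of 1 0]
  have "mexp (2 *\<^sub>R X) ** mexp (- X) ** mexp X = mexp X ** mexp X"
    by simp
  then show ?thesis
    by (simp add: matrix_mul_assoc[symmetric] mexp_neg_left)
qed

lemma so_scaleR: "X \<in> so \<Longrightarrow> s *\<^sub>R X \<in> so"
  by (simp add: so_def matvec_simps form_simps flip: distrib_left)

text \<open>The determinant is the square of that of the isometry
  \<open>mexp ((1 / 2) *\<^sub>R X)\<close>, which is 1 or -1.\<close>

lemma mexp_SO:
  assumes "X \<in> so"
  shows "mexp X \<in> SO"
proof -
  have half: "(1 / 2) *\<^sub>R X \<in> so" using assms by (rule so_scaleR)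
  have "det (mexp X) = det (mexp ((1 / 2) *\<^sub>R X)) ^ 2"
    using mexp_double[of "(1 / 2) *\<^sub>R X"] by (simp add: det_mul power2_eq_square)
  then show ?thesis
    using isometry_det[OF mexp_isometry[OF half]] mexp_isometry[OF assms]
    by (auto simp: SO_iff)
qed

section \<open>Paths\<close>

text \<open>Isometries act on projections by conjugation, whose derivative at the identity is a
  commutator.\<close>

lemma tangent_vector_eq:
  assumes "\<sigma> \<in> XG" "X \<in> so"
  shows "tangent_vector \<sigma> X = X ** proj_mat \<sigma> - proj_mat \<sigma> ** X"
proof -
  have eq: "matrix (form_proj ((*v) (mexp (s *\<^sub>R X)) ` \<sigma>))
      = mexp (s *\<^sub>R X) ** proj_mat \<sigma> ** mexp (- (s *\<^sub>R X))" for s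
    using isometry_proj_mat[OF mexp_isometry[OF so_scaleR[OF assms(2)]] assms(1)]
    by (simp add: proj_mat_def[symmetric] mexp_inv)
  have "((\<lambda>s. mexp (s *\<^sub>R X) ** proj_mat \<sigma>) has_vector_derivative X ** proj_mat \<sigma>) (at 0)"
    using bounded_linear.has_vector_derivative[OF matmul.bounded_linear_left[of "proj_mat \<sigma>"] mexp_deriv[of X 0]]
    by simp
  from bounded_bilinear.has_vector_derivative[OF bounded_bilinear_matrix_mult this mexp_deriv_neg[of X 0]]
  have "((\<lambda>s. mexp (s *\<^sub>R X) ** proj_mat \<sigma> ** mexp (- (s *\<^sub>R X))) has_vector_derivative
      X ** proj_mat \<sigma> - proj_mat \<sigma> ** X) (at 0)"
    by (simp add: matmul_simps)
  then show ?thesis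
    unfolding tangent_vector_def eq by (rule vector_derivative_at)
qed

text \<open>The velocity is recovered from the derivative \<open>D\<close> of the projection \<open>P\<close> as the commutator
  \<open>[D, P]\<close>, because \<open>P D P = 0\<close>.\<close>

lemma C1_path_of_projections:
  assumes XG: "\<And>t. t \<in> {0..1} \<Longrightarrow> \<gamma> t \<in> XG"
    and deriv: "\<And>t. t \<in> {0..1} \<Longrightarrow>
      ((\<lambda>s. proj_mat (\<gamma> s)) has_vector_derivative D t) (at t within {0..1})"
    and cont: "continuous_on {0..1} D"
  shows "C1_path_with_velocity \<gamma> (\<lambda>t. D t ** proj_mat (\<gamma> t) - proj_mat (\<gamma> t) ** D t)"
proof -
  let ?P = "\<lambda>t. proj_mat (\<gamma> t)"
  have "continuous_on {0..1} ?P"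
    using deriv by (meson continuous_on_eq_continuous_within has_vector_derivative_continuous)
  then have "continuous_on {0..1} (\<lambda>t. D t ** ?P t - ?P t ** D t)"
    using cont by (intro continuous_on_diff matmul.continuous_on)
  moreover have "(D t ** ?P t - ?P t ** D t) \<in> p_space (\<gamma> t) \<and>
      (?P has_vector_derivative tangent_vector (\<gamma> t) (D t ** ?P t - ?P t ** D t)) (at t within {0..1})"
    if t: "t \<in> {0..1}" for t
  proof -
    let ?X = "D t ** ?P t - ?P t ** D t"
    \<comment> \<open>Differentiating P P = P gives P D + D P = D; multiplying by P then gives P D P
      = 0.\<close>
    have "((\<lambda>s. ?P s ** ?P s) has_vector_derivative ?P t ** D t + D t ** ?P t) (at t within {0..1})"
      by (rule bounded_bilinear.has_vector_derivative[OF bounded_bilinear_matrix_mult deriv[OF t] deriv[OF t]])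
    then have "(?P has_vector_derivative ?P t ** D t + D t ** ?P t) (at t within {0..1})"
      by (rule has_vector_derivative_transform[OF t, rotated]) (simp add: proj_mat_idem XG)
    then have split: "?P t ** D t + D t ** ?P t = D t"
      using t deriv[OF t]
      by (intro vector_derivative_unique_within_closed_interval[of 0 1 t ?P]) auto
    have idem: "?P t ** ?P t = ?P t" "M ** ?P t ** ?P t = M ** ?P t" for M
      using proj_mat_idem[OF XG[OF t]] by (simp_all add: matrix_mul_assoc[symmetric])
    have "?P t ** (?P t ** D t + D t ** ?P t) = ?P t ** D t"
      by (simp add: split)
    then have PDP: "?P t ** D t ** ?P t = 0"
      by (simp add: matmul_simps matrix_mul_assoc idem)
    \<comment> \<open>Self-adjointness of P passes to its derivative, and the commutator of two
      self-adjoint maps is skew.\<close>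
    have D_adj: "form (D t *v x) y = form x (D t *v y)" for x y
    proof -
      have 1: "((\<lambda>s. form (?P s *v x) y) has_vector_derivative form (D t *v x) y) (at t within {0..1})"
        by (intro bounded_linear.has_vector_derivative[OF form.bounded_linear_left]
            bounded_linear.has_vector_derivative[OF matvec.bounded_linear_left] deriv t)
      have 2: "((\<lambda>s. form x (?P s *v y)) has_vector_derivative form x (D t *v y)) (at t within {0..1})"
        by (intro bounded_linear.has_vector_derivative[OF form.bounded_linear_right]
            bounded_linear.has_vector_derivative[OF matvec.bounded_linear_left] deriv t)
      have "((\<lambda>s. form (?P s *v x) y) has_vector_derivative form x (D t *v y)) (at t within {0..1})"
        by (rule has_vector_derivative_transform[OF t _ 2]) (simp add: proj_mat_selfadjoint XG)
      with 1 t show ?thesis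
        by (intro vector_derivative_unique_within_closed_interval[of 0 1 t]) auto
    qed
    have so: "?X \<in> so"
      using proj_mat_selfadjoint[OF XG[OF t]]
      by (simp add: so_def matvec_simps form_simps D_adj)
    moreover have "?X ** ?P t + ?P t ** ?X = ?X"
      by (simp add: matmul_simps matrix_mul_assoc idem)
    \<comment> \<open>[[D, P], P] = D P + P D - 2 P D P = D.\<close>
    moreover have "tangent_vector (\<gamma> t) ?X = D t"
      using split
      by (simp add: tangent_vector_eq[OF XG[OF t] so] matmul_simps matrix_mul_assoc idem PDP add.commute)
    ultimately show ?thesis
      using deriv[OF t] p_space_iff[OF XG[OF t]] by simp
  qed
  ultimately show ?thesis
    using XG by (simp add: C1_path_with_velocity_def proj_mat_def)
qed

lemma real_polynomial_function_det:
  fixes A :: "real \<Rightarrow> real ^ 'n ^ 'n"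
  assumes "\<And>i j. real_polynomial_function (\<lambda>s. A s $ i $ j)"
  shows "real_polynomial_function (\<lambda>s. det (A s))"
  unfolding det_def
  by (intro real_polynomial_function_sum real_polynomial_function_prod finite_permutations
      real_polynomial_function.intros(2,4) assms) auto

text \<open>Without a path the infimum in \<open>dist_XG\<close> would be taken over the empty set, with a junk value.
  Interpolating the graph maps linearly gives projections that are rational functions of the
  parameter.\<close>

lemma C1_path_exists:
  assumes "\<sigma>0 \<in> XG" "\<sigma>1 \<in> XG"
  obtains \<gamma> \<xi> where "C1_path_with_velocity \<gamma> \<xi>" "\<gamma> 0 = \<sigma>0" "\<gamma> 1 = \<sigma>1"
proof -
  obtain L0 where L0: "is_graph_map L0" "range L0 = \<sigma>0" using XG_graph_map[OF assms(1)] .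
  obtain L1 where L1: "is_graph_map L1" "range L1 = \<sigma>1" using XG_graph_map[OF assms(2)] .
  define L where "L s = (\<lambda>c. (1 - s) *\<^sub>R L0 c + s *\<^sub>R L1 c)" for s
  define \<gamma> where "\<gamma> s = range (L s)" for s
  have L: "is_graph_map (L s)" if "s \<in> {0..1}" for s
    using graph_map_convex[OF L0(1) L1(1) that] by (simp add: L_def)
  note poly_intros = real_polynomial_function.intros(2-4) real_polynomial_function_diff
    real_polynomial_function.intros(1)[OF bounded_linear_ident]
  have poly_form: "real_polynomial_function (\<lambda>s. form (L s c) x)"
      "real_polynomial_function (\<lambda>s. form (L s c) (L s e))" for c e x
    unfolding L_def form_simps real_scaleR_def by (intro poly_intros)+
  have poly_coord: "real_polynomial_function (\<lambda>s. L s c $ a)" for c a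
    unfolding L_def vector_add_component vector_scaleR_component real_scaleR_def
    by (intro poly_intros)
  have poly_gram: "real_polynomial_function (\<lambda>s. det (gram (L s)))"
    by (rule real_polynomial_function_det) (simp add: gram_def poly_form)
  have poly_replace: "real_polynomial_function (\<lambda>s. det (gram_replace (L s) x k))" for x k
  proof (rule real_polynomial_function_det)
    show "real_polynomial_function (\<lambda>s. gram_replace (L s) x k $ i $ j)" for i j
      by (cases "j = k") (simp_all add: gram_replace_def gram_def poly_form)
  qed
  \<comment> \<open>Cramer's rule column by column with the common denominator, the Gram
    determinant, cleared; the entries are then polynomials in \<open>s\<close>.\<close>
  define M where "M s = (\<chi> a b. \<Sum>k\<in>UNIV. det (gram_replace (L s) (axis b 1) k) * L s (axis k 1) $ a)" for s
  have "polynomial_function M"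
    unfolding polynomial_function_iff_Basis_inner
  proof
    fix b :: "('a, 'b) mat_pq" assume "b \<in> Basis"
    then obtain i j where b: "b = axis i (axis j 1)"
      by (auto simp: Basis_vec_def)
    show "real_polynomial_function (\<lambda>s. M s \<bullet> b)"
      by (auto simp: b inner_axis M_def poly_replace poly_coord
          intro!: real_polynomial_function_sum real_polynomial_function.intros(4))
  qed
  then obtain M' where M': "polynomial_function M'" "\<And>s. (M has_vector_derivative M' s) (at s)"
    using has_vector_derivative_polynomial_function by blast
  obtain d' where d': "real_polynomial_function d'" "\<And>s. ((\<lambda>s. det (gram (L s))) has_real_derivative d' s) (at s)"
    using has_real_derivative_polynomial_function[OF poly_gram] by blast
  let ?d = "\<lambda>s. det (gram (L s))"
  have nz: "?d s \<noteq> 0" if "s \<in> {0..1}" for s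
    using det_gram_nonzero[OF L[OF that]] .
  have XG: "\<gamma> s \<in> XG" if "s \<in> {0..1}" for s
    using graph_map_XG[OF L[OF that]] by (simp add: \<gamma>_def)
  have P: "proj_mat (\<gamma> s) = inverse (?d s) *\<^sub>R M s" if s: "s \<in> {0..1}" for s
  proof -
    have "proj_mat (\<gamma> s) $ a $ b = (inverse (?d s) *\<^sub>R M s) $ a $ b" for a b
    proof -
      have "proj_mat (\<gamma> s) $ a $ b = (proj_mat (\<gamma> s) *v axis b 1) $ a"
        by (simp add: matrix_vector_mul_component inner_axis)
      also have "\<dots> = L s (\<chi> k. det (gram_replace (L s) (axis b 1) k) / ?d s) $ a"
        using form_proj_cramer[OF L[OF s]] XG[OF s] by (simp add: proj_mat_mult \<gamma>_def)
      also have "\<dots> = (\<Sum>k\<in>UNIV. det (gram_replace (L s) (axis b 1) k) / ?d s * L s (axis k 1) $ a)"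
        using L[OF s] by (subst graph_map_expand) (auto simp: is_graph_map_def)
      also have "\<dots> = (inverse (?d s) *\<^sub>R M s) $ a $ b"
        by (simp add: M_def sum_distrib_left field_simps)
      finally show ?thesis .
    qed
    then show ?thesis by (simp add: vec_eq_iff)
  qed
  define D where "D s = inverse (?d s) *\<^sub>R M' s + (- (inverse (?d s) * d' s * inverse (?d s))) *\<^sub>R M s" for s
  have "((\<lambda>s. proj_mat (\<gamma> s)) has_vector_derivative D t) (at t within {0..1})" if t: "t \<in> {0..1}" for t
  proof (rule has_vector_derivative_transform[OF t P])
    have "((\<lambda>s. inverse (?d s)) has_real_derivative - (inverse (?d t) * d' t * inverse (?d t))) (at t)"
      by (rule DERIV_inverse'[OF d'(2) nz[OF t]])
    from has_vector_derivative_scaleR[OF this M'(2)]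
    show "((\<lambda>s. inverse (?d s) *\<^sub>R M s) has_vector_derivative D t) (at t within {0..1})"
      unfolding D_def by (rule has_vector_derivative_at_within)
  qed
  moreover have "continuous_on {0..1} D"
    unfolding D_def
    using nz \<open>polynomial_function M\<close> M'(1) d'(1) poly_gram
    by (intro continuous_intros continuous_on_polymonial_function)
      (auto simp: real_polynomial_function_eq)
  ultimately have "C1_path_with_velocity \<gamma> (\<lambda>t. D t ** proj_mat (\<gamma> t) - proj_mat (\<gamma> t) ** D t)"
    using XG by (intro C1_path_of_projections)
  moreover have "\<gamma> 0 = \<sigma>0" "\<gamma> 1 = \<sigma>1"
    using L0 L1 by (simp_all add: \<gamma>_def L_def)
  ultimately show ?thesis by (rule that)
qed

section \<open>The distance\<close>

lemma normalized_killing_eq: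
  fixes X :: "('p::finite, 'q::finite) mat_pq"
  assumes "CARD('p) + CARD('q) > 2"
  shows "normalized_killing X X = trace (X ** X) / 2"
proof -
  have "real (CARD('p) + CARD('q)) > 2"
    using assms by linarith
  then show ?thesis
    by (simp add: normalized_killing_def killing_def field_simps)
qed

lemma C1_path_speed:
  fixes \<xi> :: "real \<Rightarrow> ('p::finite, 'q::finite) mat_pq"
  assumes "CARD('p) + CARD('q) > 2" "C1_path_with_velocity \<gamma> \<xi>"
  shows "(\<lambda>t. sqrt (normalized_killing (\<xi> t) (\<xi> t))) integrable_on {0..1}"
    and "t \<in> {0..1} \<Longrightarrow> 0 \<le> normalized_killing (\<xi> t) (\<xi> t)"
proof -
  have "continuous_on {0..1} \<xi>"
    using assms by (simp add: C1_path_with_velocity_def)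
  then have "continuous_on {0..1} (\<lambda>t. sqrt (normalized_killing (\<xi> t) (\<xi> t)))"
    unfolding normalized_killing_eq[OF assms(1)] trace_def
    by (intro continuous_intros matmul.continuous_on) auto
  then show "(\<lambda>t. sqrt (normalized_killing (\<xi> t) (\<xi> t))) integrable_on {0..1}"
    by (rule integrable_continuous_interval)
  show "0 \<le> normalized_killing (\<xi> t) (\<xi> t)" if "t \<in> {0..1}"
    using assms that trace_square_p_space_nonneg[of "\<gamma> t" "\<xi> t"]
    by (simp add: normalized_killing_eq[OF assms(1)] C1_path_with_velocity_def)
qed

text \<open>For \<open>form v v = -1\<close> this turns out to be the squared hyperbolic sine of the distance from
  \<open>\<sigma>\<close> to \<open>S_sub (span {v})\<close>.\<close>

definition gap :: "('p::finite, 'q::finite) vec_pq \<Rightarrow> ('p, 'q) vec_pq set \<Rightarrow> real" where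
  "gap v \<sigma> = form (v - form_proj \<sigma> v) (v - form_proj \<sigma> v)"

lemma gap_nonneg:
  assumes "\<sigma> \<in> XG"
  shows "0 \<le> gap v \<sigma>"
  using form_perp_posdef[OF assms form_proj_perp[OF assms, of v]]
  by (cases "v - form_proj \<sigma> v = 0") (auto simp: gap_def form_simps)

text \<open>The first formula is affine in the projection matrix, hence easy to differentiate along
  a path. The second is Pythagoras and gives the norm of the component in
  \<open>\<sigma>\<close>.\<close>

lemma gap_eq:
  assumes "\<sigma> \<in> XG"
  shows "gap v \<sigma> = form v v - form (proj_mat \<sigma> *v v) v"
    and "gap v \<sigma> = form v v - form (form_proj \<sigma> v) (form_proj \<sigma> v)"
  using form_perpD[OF form_proj_perp[OF assms, of v] form_proj_in[OF assms, of v]]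
  by (simp_all add: gap_def proj_mat_mult[OF assms] form_simps form_commute)

lemma path_length_ge:
  fixes \<xi> :: "real \<Rightarrow> ('p::finite, 'q::finite) mat_pq"
  assumes d: "CARD('p) + CARD('q) > 2" and path: "C1_path_with_velocity \<gamma> \<xi>"
    and v: "form v v = -1"
  shows "arsinh (sqrt (gap v (\<gamma> 0))) - arsinh (sqrt (gap v (\<gamma> 1))) \<le> path_length \<xi>"
proof -
  have XG: "\<gamma> t \<in> XG" and p: "\<xi> t \<in> p_space (\<gamma> t)"
    and deriv: "((\<lambda>s. proj_mat (\<gamma> s)) has_vector_derivative tangent_vector (\<gamma> t) (\<xi> t)) (at t within {0..1})"
    if "t \<in> {0..1}" for t
    using path that by (auto simp: C1_path_with_velocity_def proj_mat_def)
  define f where "f t = gap v (\<gamma> t)" for t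
  define f' where "f' t = - 2 * form (\<xi> t *v form_proj (\<gamma> t) v) (v - form_proj (\<gamma> t) v)" for t
  have f_nonneg: "0 \<le> f t" if "t \<in> {0..1}" for t
    using gap_nonneg[OF XG[OF that]] by (simp add: f_def)
  have f_deriv: "(f has_real_derivative f' t) (at t within {0..1})" if t: "t \<in> {0..1}" for t
  proof -
    let ?a = "form_proj (\<gamma> t) v"
    have so: "\<xi> t \<in> so" using p[OF t] by (simp add: p_space_def)
    have "((\<lambda>s. form v v - form (proj_mat (\<gamma> s) *v v) v) has_vector_derivative
        0 - form (tangent_vector (\<gamma> t) (\<xi> t) *v v) v) (at t within {0..1})"
      by (intro has_vector_derivative_diff has_vector_derivative_const
          bounded_linear.has_vector_derivative[OF form.bounded_linear_left]
          bounded_linear.has_vector_derivative[OF matvec.bounded_linear_left] deriv t)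
    then have "(f has_vector_derivative 0 - form (tangent_vector (\<gamma> t) (\<xi> t) *v v) v) (at t within {0..1})"
      by (rule has_vector_derivative_transform[OF t, rotated]) (simp add: f_def gap_eq(1) XG)
    \<comment> \<open>By skewness the two terms of the commutator merge into twice one of them, and
      since this diagonal term vanishes, the remaining \<open>v\<close> may be replaced by
      \<open>v - ?a\<close>.\<close>
    moreover have "form (\<xi> t *v ?a) ?a = 0"
      using so_skew[OF so, of ?a ?a] by (simp add: form_commute)
    then have "0 - form (tangent_vector (\<gamma> t) (\<xi> t) *v v) v = f' t"
      using so_skew[OF so, of v ?a]
      by (simp add: tangent_vector_eq[OF XG[OF t] so] matvec_simps proj_mat_mult[OF XG[OF t]]
          form_simps form_proj_selfadjoint[OF XG[OF t]] f'_def form_commute)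
    ultimately show ?thesis
      by (simp add: has_real_derivative_iff_has_vector_derivative)
  qed
  let ?speed = "\<lambda>t. sqrt (normalized_killing (\<xi> t) (\<xi> t))"
  have f'_bound: "\<bar>f' t\<bar> \<le> 2 * ?speed t * sqrt (f t * (1 + f t))" if t: "t \<in> {0..1}" for t
  proof -
    let ?a = "form_proj (\<gamma> t) v" and ?b = "v - form_proj (\<gamma> t) v"
    \<comment> \<open>The normalization of \<open>v\<close> enters here: if \<open>f t\<close> is
      the square of sinh, then \<open>- form ?a ?a\<close> is the square of cosh.\<close>
    have "- form ?a ?a = 1 + f t"
      using gap_eq(2)[OF XG[OF t], of v] v by (simp add: f_def)
    then have "(form (\<xi> t *v ?a) ?b)\<^sup>2 \<le> normalized_killing (\<xi> t) (\<xi> t) * ((1 + f t) * f t)"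
      using p_space_speed_bound[OF XG[OF t] p[OF t] form_proj_in[OF XG[OF t], of v] form_proj_perp[OF XG[OF t], of v]]
      by (simp add: normalized_killing_eq[OF d] f_def gap_def)
    then have "\<bar>form (\<xi> t *v ?a) ?b\<bar> \<le> ?speed t * sqrt ((1 + f t) * f t)"
      by (metis real_sqrt_abs real_sqrt_le_mono real_sqrt_mult)
    then show ?thesis
      by (simp add: f'_def abs_mult mult.commute mult.left_commute)
  qed
  \<comment> \<open>\<open>sqrt \<circ> f\<close> need not be differentiable where the gap vanishes, hence the shift by \<open>e\<close>.\<close>
  have approx: "arsinh (sqrt (f 0 + e)) - arsinh (sqrt (f 1 + e)) \<le> path_length \<xi>" if e: "e > 0" for e
  proof -
    define F where "F t = arsinh (sqrt (f t + e))" for t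
    define F' where "F' t = f' t / (2 * sqrt ((f t + e) * (1 + f t + e)))" for t
    have F_deriv: "(F has_vector_derivative F' t) (at t within {0..1})" if t: "t \<in> {0..1}" for t
    proof -
      have "f t + e > 0" using f_nonneg[OF t] e by simp
      then have "((\<lambda>t. sqrt (f t + e)) has_real_derivative f' t / (2 * sqrt (f t + e))) (at t within {0..1})"
        by (auto intro!: derivative_eq_intros f_deriv[OF t] simp: field_simps)
      from DERIV_chain2[OF arsinh_real_has_field_derivative this] \<open>f t + e > 0\<close>
      have "(F has_real_derivative F' t) (at t within {0..1})"
        by (simp add: F_def[abs_def] F'_def real_sqrt_mult mult_ac add_ac)
      then show ?thesis by (simp add: has_real_derivative_iff_has_vector_derivative)
    qed
    have int: "(F' has_integral (F 1 - F 0)) {0..1}"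
      by (rule fundamental_theorem_of_calculus) (auto intro: F_deriv)
    have "norm (F' t) \<le> ?speed t" if t: "t \<in> {0..1}" for t
    proof -
      have pos: "0 < (f t + e) * (1 + f t + e)" using f_nonneg[OF t] e by (intro mult_pos_pos) auto
      \<comment> \<open>The shift only enlarges the root in the denominator of \<open>F'\<close>, so
        the bound by the speed is uniform in \<open>e\<close>.\<close>
      have "sqrt (f t * (1 + f t)) \<le> sqrt ((f t + e) * (1 + f t + e))"
        using f_nonneg[OF t] e by (intro real_sqrt_le_mono mult_mono) auto
      then have "2 * ?speed t * sqrt (f t * (1 + f t)) \<le> 2 * ?speed t * sqrt ((f t + e) * (1 + f t + e))"
        using C1_path_speed(2)[OF d path t] by (intro mult_left_mono) auto
      from order_trans[OF f'_bound[OF t] this]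
      have "\<bar>f' t\<bar> \<le> ?speed t * (2 * sqrt ((f t + e) * (1 + f t + e)))"
        by (simp only: mult_ac)
      then show ?thesis
        using pos by (simp add: F'_def abs_mult pos_divide_le_eq)
    qed
    then have "norm (integral {0..1} F') \<le> path_length \<xi>"
      unfolding path_length_def
      using int C1_path_speed(1)[OF d path] by (intro integral_norm_bound_integral) auto
    then show ?thesis
      using int by (simp add: integral_unique F_def)
  qed
  have "((\<lambda>e. arsinh (sqrt (f 0 + e)) - arsinh (sqrt (f 1 + e))) \<longlongrightarrow>
      arsinh (sqrt (f 0 + 0)) - arsinh (sqrt (f 1 + 0))) (at_right 0)"
    by (intro tendsto_intros)
  moreover have "eventually (\<lambda>e. arsinh (sqrt (f 0 + e)) - arsinh (sqrt (f 1 + e)) \<le> path_length \<xi>) (at_right (0::real))"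
    using approx by (auto simp: eventually_at_right_field intro!: exI[of _ 1])
  ultimately show ?thesis
    using tendsto_upperbound[of _ _ "at_right (0::real)"] by (fastforce simp: f_def)
qed

lemma path_length_nonneg:
  fixes \<xi> :: "real \<Rightarrow> ('p::finite, 'q::finite) mat_pq"
  assumes "CARD('p) + CARD('q) > 2" "C1_path_with_velocity \<gamma> \<xi>"
  shows "0 \<le> path_length \<xi>"
  unfolding path_length_def
  using C1_path_speed[OF assms] by (intro integral_nonneg) auto

lemma dist_XG_le:
  fixes \<xi> :: "real \<Rightarrow> ('p::finite, 'q::finite) mat_pq"
  assumes "CARD('p) + CARD('q) > 2" "C1_path_with_velocity \<gamma> \<xi>"
  shows "dist_XG (\<gamma> 0) (\<gamma> 1) \<le> path_length \<xi>"
  unfolding dist_XG_def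
  using assms path_length_nonneg by (intro cInf_lower bdd_belowI[of _ 0]) blast+

lemma dist_XG_ge:
  fixes \<sigma> \<sigma>' :: "('p::finite, 'q::finite) vec_pq set"
  assumes "CARD('p) + CARD('q) > 2" "\<sigma> \<in> XG" "\<sigma>' \<in> XG" "form v v = -1"
  shows "arsinh (sqrt (gap v \<sigma>)) - arsinh (sqrt (gap v \<sigma>')) \<le> dist_XG \<sigma> \<sigma>'"
  unfolding dist_XG_def
proof (rule cInf_greatest)
  show "{path_length \<xi> |\<gamma> \<xi>. C1_path_with_velocity \<gamma> \<xi> \<and> \<gamma> 0 = \<sigma> \<and> \<gamma> 1 = \<sigma>'} \<noteq> {}"
    using C1_path_exists[OF assms(2,3)] by blast
qed (use path_length_ge[OF assms(1) _ assms(4)] in blast)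

section \<open>The length of one-parameter curves\<close>

lemma mexp_conj:
  fixes A X :: "real ^ 'n ^ 'n"
  assumes "invertible A"
  shows "mexp (A ** X ** matrix_inv A) = A ** mexp X ** matrix_inv A"
proof -
  have cancel: "M ** matrix_inv A ** A ** N = M ** N" for M N :: "real ^ 'n ^ 'n"
    by (metis matrix_inv_mult(2)[OF assms] matrix_mul_assoc matrix_mul_rid)
  have "matpow (A ** X ** matrix_inv A) n = A ** matpow X n ** matrix_inv A" for n
    by (induction n) (simp_all add: matrix_inv_mult[OF assms] matpow_Suc matrix_mul_assoc cancel)
  then have "mexp (A ** X ** matrix_inv A) = (\<Sum>n. A ** ((1 / fact n) *\<^sub>R matpow X n) ** matrix_inv A)"
    by (simp add: mexp_eq matmul_simps)
  also have "\<dots> = A ** mexp X ** matrix_inv A"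
    unfolding mexp_eq
    by (rule bounded_linear.suminf[symmetric, OF _ mexp_summable])
      (rule bounded_linear_compose[OF matmul.bounded_linear_left matmul.bounded_linear_right])
  finally show ?thesis .
qed

text \<open>The orbit curve of exp((s - 1) Y) through \<open>\<sigma>\<close> has constant velocity
  \<open>Y\<close>, so its length is the norm of \<open>Y\<close>.\<close>

lemma dist_XG_mexp_le:
  fixes \<sigma> :: "('p::finite, 'q::finite) vec_pq set"
  assumes d: "CARD('p) + CARD('q) > 2" and \<sigma>: "\<sigma> \<in> XG" and Y: "Y \<in> p_space \<sigma>"
  shows "dist_XG ((*v) (mexp (- Y)) ` \<sigma>) \<sigma> \<le> sqrt (normalized_killing Y Y)"
proof -
  \<comment> \<open>Spelled \<open>1 * s + - 1\<close> to match \<open>mexp_deriv_shift\<close>; the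
    curve reaches \<open>\<sigma>\<close> at time 1.\<close>
  define \<gamma> where "\<gamma> s = (*v) (mexp ((1 * s + - 1) *\<^sub>R Y)) ` \<sigma>" for s
  have so: "Y \<in> so" using Y by (simp add: p_space_def)
  note iso = mexp_isometry[OF so_scaleR[OF so]]
  have XG: "\<gamma> s \<in> XG" for s
    unfolding \<gamma>_def by (rule isometry_image_XG[OF iso \<sigma>])
  have p: "Y \<in> p_space (\<gamma> s)" for s
  proof -
    let ?E = "mexp ((1 * s + - 1) *\<^sub>R Y)"
    \<comment> \<open>\<open>Y\<close> commutes with its own exponentials, hence stays tangent at
      the moving point.\<close>
    have "?E ** Y ** matrix_inv ?E = Y"
      by (metis matrix_inv_mult(1)[OF isometry_invertible[OF iso]] matrix_mul_assoc matrix_mul_rid mexp_scaleR_commute)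
    then show ?thesis
      using isometry_conj_p_space[OF iso \<sigma> Y, of "1 * s + - 1"] by (simp only: \<gamma>_def)
  qed
  have P: "proj_mat (\<gamma> s) = mexp ((1 * s + - 1) *\<^sub>R Y) ** proj_mat \<sigma> ** mexp ((- 1 * s + 1) *\<^sub>R Y)" for s
    unfolding \<gamma>_def isometry_proj_mat[OF iso \<sigma>] mexp_inv by (simp add: algebra_simps)
  have "((\<lambda>s. proj_mat (\<gamma> s)) has_vector_derivative tangent_vector (\<gamma> t) Y) (at t within {0..1})" for t
  proof -
    have "((\<lambda>s. mexp ((1 * s + - 1) *\<^sub>R Y) ** proj_mat \<sigma>) has_vector_derivative
        (1 *\<^sub>R (Y ** mexp ((1 * t + - 1) *\<^sub>R Y))) ** proj_mat \<sigma>) (at t)"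
      by (rule bounded_linear.has_vector_derivative[OF matmul.bounded_linear_left mexp_deriv_shift])
    from bounded_bilinear.has_vector_derivative[OF bounded_bilinear_matrix_mult this mexp_deriv_shift[of "- 1" 1 Y t]]
    have "((\<lambda>s. proj_mat (\<gamma> s)) has_vector_derivative Y ** proj_mat (\<gamma> t) - proj_mat (\<gamma> t) ** Y) (at t)"
      unfolding P mexp_scaleR_commute[of Y "- 1 * t + 1"]
      by (simp add: matmul_simps matrix_mul_assoc)
    then show ?thesis
      by (simp add: tangent_vector_eq[OF XG so] has_vector_derivative_at_within)
  qed
  then have "C1_path_with_velocity \<gamma> (\<lambda>_. Y)"
    using XG p by (simp add: C1_path_with_velocity_def proj_mat_def)
  from dist_XG_le[OF d this] show ?thesis
    by (simp add: \<gamma>_def path_length_def image_def)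
qed

section \<open>The projective group\<close>

lemma SL_simps [simp]: "carrier SL = {A. det A = 1}" "mult SL = (**)" "one SL = mat 1"
  by (simp_all add: SL_def)

lemma det_inv:
  fixes A :: "real ^ 'n ^ 'n"
  assumes "det A = 1"
  shows "det (matrix_inv A) = 1"
proof -
  have "invertible A" using assms by (simp add: invertible_det_nz)
  then have "det A * det (matrix_inv A) = 1"
    by (metis det_I det_mul matrix_inv_mult(1))
  then show ?thesis using assms by simp
qed

lemma group_SL: "group (SL :: (real ^ 'n ^ 'n) monoid)"
proof (rule groupI)
  fix A :: "real ^ 'n ^ 'n" assume "A \<in> carrier SL"
  then show "\<exists>B\<in>carrier SL. B \<otimes>\<^bsub>SL\<^esub> A = \<one>\<^bsub>SL\<^esub>"
    by (intro bexI[of _ "matrix_inv A"])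
      (auto simp: det_inv matrix_inv_mult invertible_det_nz)
qed (auto simp: det_mul matrix_mul_assoc)

lemma inv_SL:
  fixes A :: "real ^ 'n ^ 'n"
  assumes "det A = 1"
  shows "inv\<^bsub>SL\<^esub> A = matrix_inv A"
  using assms
  by (intro group.inv_equality[OF group_SL]) (auto simp: det_inv matrix_inv_mult invertible_det_nz)

lemma mat_mult_eq: "mat c ** A = c *\<^sub>R A" for A :: "real ^ 'n ^ 'n"
  by (simp add: vec_eq_iff matrix_matrix_mult_def mat_def if_distrib[of "\<lambda>x. x * _"] cong: if_cong)

lemma mult_mat_eq: "A ** mat c = c *\<^sub>R A" for A :: "real ^ 'n ^ 'n"
  by (simp add: vec_eq_iff matrix_matrix_mult_def mat_def if_distrib[of "\<lambda>x. _ * x"] cong: if_cong)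

lemma mat_mult_mat: "mat c ** mat d = (mat (c * d) :: real ^ 'n ^ 'n)"
  unfolding mat_mult_eq by (simp add: vec_eq_iff mat_def)

lemma scalars_normal: "(scalars :: (real ^ 'n ^ 'n) set) \<lhd> SL"
proof -
  interpret group "SL :: (real ^ 'n ^ 'n) monoid" by (rule group_SL)
  have "subgroup (scalars :: (real ^ 'n ^ 'n) set) SL"
  proof (rule subgroupI)
    show "(scalars :: (real ^ 'n ^ 'n) set) \<subseteq> carrier SL" by (auto simp: scalars_def)
    show "(scalars :: (real ^ 'n ^ 'n) set) \<noteq> {}" by (auto simp: scalars_def intro!: exI[of _ "mat 1"])
  next
    fix A :: "real ^ 'n ^ 'n" assume A: "A \<in> scalars"
    then obtain c where c: "A = mat c" "det A = 1" by (auto simp: scalars_def)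
    have "c \<noteq> 0"
    proof
      assume "c = 0"
      then have "A = mat 0" by (simp add: c)
      with c(2) show False by (metis det_0 zero_neq_one)
    qed
    then have "A ** mat (1 / c) = mat 1"
      by (simp add: c(1) mat_mult_mat)
    then have "matrix_inv A = mat (1 / c)" by (rule matrix_inv_unique)
    then show "inv\<^bsub>SL\<^esub> A \<in> scalars"
      using c(2) det_inv[OF c(2)] by (auto simp: scalars_def inv_SL)
  next
    fix A B :: "real ^ 'n ^ 'n" assume "A \<in> scalars" "B \<in> scalars"
    then obtain c d where "A = mat c" "B = mat d" "det A = 1" "det B = 1" by (auto simp: scalars_def)
    moreover from this have "det (A ** B) = 1" by (simp add: det_mul)
    ultimately show "A \<otimes>\<^bsub>SL\<^esub> B \<in> scalars"
      by (auto simp: scalars_def mat_mult_mat)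
  qed
  moreover have "scalars #>\<^bsub>SL\<^esub> A = A <#\<^bsub>SL\<^esub> scalars" for A :: "real ^ 'n ^ 'n"
    by (auto simp: r_coset_def l_coset_def scalars_def mat_mult_eq mult_mat_eq)
  ultimately show ?thesis by (intro normalI) auto
qed

lemma projectivize_self:
  assumes "det A = 1"
  shows "A \<in> projectivize A"
proof -
  have "mat 1 ** A \<in> projectivize A"
    using assms by (auto simp: projectivize_def r_coset_def scalars_def intro!: exI[of _ "mat 1"])
  then show ?thesis by simp
qed

lemma projectivize_mem: "B \<in> projectivize A \<Longrightarrow> \<exists>c. det (mat c :: real ^ 'n ^ 'n) = 1 \<and> B = c *\<^sub>R A"
  for A B :: "real ^ 'n ^ 'n"
  by (auto simp: projectivize_def r_coset_def scalars_def mat_mult_eq)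

lemma projectivize_mult:
  assumes "det A = 1" "det B = 1"
  shows "projectivize A \<otimes>\<^bsub>PSO\<^esub> projectivize B = projectivize (A ** B)"
  using normal.rcos_sum[OF scalars_normal, of A B] assms
  by (simp add: PSO_def PSL_def FactGroup_def projectivize_def)

lemma one_PSO: "\<one>\<^bsub>PSO\<^esub> = projectivize (mat 1 :: ('p::finite, 'q::finite) mat_pq)"
proof -
  have "(scalars :: ('p, 'q) mat_pq set) #>\<^bsub>SL\<^esub> mat 1 = scalars"
    by (auto simp: r_coset_def scalars_def)
  then show ?thesis by (simp add: PSO_def PSL_def FactGroup_def projectivize_def)
qed

lemma carrier_PSO: "carrier PSO = projectivize ` SO"
  by (simp add: PSO_def)

lemma SO_mult: "A \<in> SO \<Longrightarrow> B \<in> SO \<Longrightarrow> A ** B \<in> SO"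
  by (simp add: SO_iff det_mul isometry_mult)

lemma SO_inv: "A \<in> SO \<Longrightarrow> matrix_inv A \<in> SO"
  by (simp add: SO_iff det_inv isometry_inv)

lemma SO_det: "A \<in> SO \<Longrightarrow> det A = 1"
  by (simp add: SO_iff)

lemma SO_isometry: "A \<in> SO \<Longrightarrow> isometry A"
  by (simp add: SO_iff)

lemma SO_inv_mult: "A \<in> SO \<Longrightarrow> A ** matrix_inv A = mat 1" "A \<in> SO \<Longrightarrow> matrix_inv A ** A = mat 1"
  using matrix_inv_mult isometry_invertible SO_isometry by blast+

lemma group_PSO: "group (PSO :: ('p::finite, 'q::finite) mat_pq set monoid)"
proof (rule groupI)
  show "\<one>\<^bsub>PSO\<^esub> \<in> carrier (PSO :: ('p, 'q) mat_pq set monoid)"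
    by (auto simp: one_PSO carrier_PSO SO_iff)
next
  fix g h k :: "('p, 'q) mat_pq set"
  assume "g \<in> carrier PSO" "h \<in> carrier PSO" "k \<in> carrier PSO"
  then show "g \<otimes>\<^bsub>PSO\<^esub> h \<otimes>\<^bsub>PSO\<^esub> k = g \<otimes>\<^bsub>PSO\<^esub> (h \<otimes>\<^bsub>PSO\<^esub> k)"
    by (auto simp: carrier_PSO projectivize_mult SO_det det_mul matrix_mul_assoc)
next
  fix g :: "('p, 'q) mat_pq set"
  assume "g \<in> carrier PSO"
  then obtain A where A: "A \<in> SO" "g = projectivize A" by (auto simp: carrier_PSO)
  then have "projectivize (matrix_inv A) \<otimes>\<^bsub>PSO\<^esub> g = \<one>\<^bsub>PSO\<^esub>"
    by (simp add: projectivize_mult SO_det SO_inv SO_inv_mult one_PSO)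
  then show "\<exists>h\<in>carrier PSO. h \<otimes>\<^bsub>PSO\<^esub> g = \<one>\<^bsub>PSO\<^esub>"
    using SO_inv[OF A(1)] by (auto simp: carrier_PSO)
qed (auto simp: carrier_PSO projectivize_mult SO_det SO_mult one_PSO)

lemma inv_PSO:
  assumes "A \<in> SO"
  shows "inv\<^bsub>PSO\<^esub> (projectivize A) = projectivize (matrix_inv A)"
  using assms SO_inv[OF assms]
  by (intro group.inv_equality[OF group_PSO])
    (auto simp: carrier_PSO projectivize_mult SO_det SO_inv_mult one_PSO)

lemma act_projectivize:
  assumes "det A = 1" "subspace W"
  shows "act (projectivize A) W = (*v) A ` W"
proof
  show "act (projectivize A) W \<subseteq> (*v) A ` W"
  proof
    fix y assume "y \<in> act (projectivize A) W"
    then obtain B x where "B \<in> projectivize A" "x \<in> W" "y = B *v x"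
      by (auto simp: act_def)
    then obtain c where "B = c *\<^sub>R A"
      using projectivize_mem by blast
    then have "y = A *v (c *\<^sub>R x)"
      using \<open>y = B *v x\<close> by (simp add: matvec_simps)
    then show "y \<in> (*v) A ` W"
      using \<open>x \<in> W\<close> assms(2) by (auto simp: subspace_scale)
  qed
  show "(*v) A ` W \<subseteq> act (projectivize A) W"
    using projectivize_self[OF assms(1)] by (auto simp: act_def)
qed

lemma stabilizer_iff:
  assumes "subspace W"
  shows "k \<in> stabilizer W \<longleftrightarrow> (\<exists>K\<in>SO. k = projectivize K \<and> (*v) K ` W = W)"
  using act_projectivize[OF SO_det assms] by (auto simp: stabilizer_def carrier_PSO)

section \<open>Reflections\<close>

text \<open>With \<open>C\<close> the identity matrix whose column \<open>k\<close> is replaced by \<open>u\<close>, the matrix \<open>1 - u v\<^sup>T\<close> is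
  intertwined by \<open>C\<close> with a matrix \<open>D\<close> that differs from the identity in row \<open>k\<close> only.\<close>

lemma det_rank_one_update:
  fixes u v :: "real ^ 'n"
  shows "det (matrix (\<lambda>x. x - (v \<bullet> x) *\<^sub>R u)) = 1 - v \<bullet> u"
proof (cases "u = 0")
  case True
  have "matrix (\<lambda>x. x) = (mat 1 :: real ^ 'n ^ 'n)"
    using matrix_id_mat_1 by (simp add: id_def)
  with True show ?thesis by simp
next
  case False
  then obtain k where k: "u $ k \<noteq> 0" by (auto simp: vec_eq_iff)
  have entry: "matrix f $ i $ j = f (axis j 1) $ i" for f :: "real ^ 'n \<Rightarrow> real ^ 'n" and i j
    by (simp add: matrix_def)
  \<comment> \<open>Solved from \<open>M ** C = C ** D\<close>, which requires
    \<open>w \<bullet> x - x $ k = - (v \<bullet> (C *v x))\<close> for all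
    \<open>x\<close>.\<close>
  define w where "w = axis k (1 - v \<bullet> u + v $ k) - v"
  define M where "M = matrix (\<lambda>x. x - (v \<bullet> x) *\<^sub>R u)"
  define C where "C = matrix (\<lambda>x. x + x $ k *\<^sub>R (u - axis k 1))"
  define D :: "real ^ 'n ^ 'n" where "D = matrix (\<lambda>x. x + (w \<bullet> x - x $ k) *\<^sub>R axis k 1)"
  have M: "M *v x = x - (v \<bullet> x) *\<^sub>R u" for x
    unfolding M_def by (rule matrix_apply) (auto intro!: linearI simp: algebra_simps inner_add_right)
  have C: "C *v x = x + x $ k *\<^sub>R (u - axis k 1)" for x
    unfolding C_def by (rule matrix_apply) (auto intro!: linearI simp: algebra_simps)
  have D: "D *v x = x + (w \<bullet> x - x $ k) *\<^sub>R axis k 1" for x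
    unfolding D_def by (rule matrix_apply) (auto intro!: linearI simp: algebra_simps inner_add_right)
  have "M ** C = C ** D"
    by (rule matrix_eqI)
      (simp add: matvec_simps M C D w_def inner_axis inner_axis' inner_simps algebra_simps)
  then have "det M * det C = det C * det D"
    by (metis det_mul)
  \<comment> \<open>\<open>cramer_lemma\<close> at the identity matrix computes the determinant of
    the identity with one column replaced; for \<open>D\<close> it is applied to the
    transpose.\<close>
  moreover have "C = (\<chi> i j. if j = k then (mat 1 *v u) $ i else mat 1 $ i $ j)"
    unfolding matrix_vector_mul_lid by (auto simp: vec_eq_iff C_def entry axis_def mat_def)
  then have "det C = u $ k"
    using cramer_lemma[of k "mat 1" u] by simp
  moreover have "transpose D = (\<chi> i j. if j = k then (mat 1 *v w) $ i else mat 1 $ i $ j)"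
    unfolding matrix_vector_mul_lid
    by (auto simp: vec_eq_iff D_def entry transpose_def inner_axis) (auto simp: axis_def mat_def)
  then have "det D = w $ k"
    using cramer_lemma[of k "mat 1" w] det_transpose[of D] by simp
  moreover have "w $ k = 1 - v \<bullet> u"
    by (simp add: w_def)
  ultimately show ?thesis using k by (simp add: M_def)
qed

definition reflection :: "('p::finite, 'q::finite) vec_pq \<Rightarrow> ('p, 'q) mat_pq" where
  "reflection z = matrix (\<lambda>x. x - (2 * form x z / form z z) *\<^sub>R z)"

lemma reflection_mult: "reflection z *v x = x - (2 * form x z / form z z) *\<^sub>R z"
  unfolding reflection_def
  by (rule matrix_apply) (auto intro!: linearI simp: form_simps algebra_simps add_divide_distrib)

lemma reflection_isometry:
  assumes "form z z \<noteq> 0"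
  shows "isometry (reflection z)"
  unfolding isometry_def
proof (intro allI)
  fix x y
  show "form (reflection z *v x) (reflection z *v y) = form x y"
    using assms form_commute[of z y] by (simp add: reflection_mult form_simps)
qed

lemma reflection_det:
  assumes "form z z \<noteq> 0"
  shows "det (reflection z) = -1"
proof -
  have "reflection z = matrix (\<lambda>x. x - (((2 / form z z) *\<^sub>R flip_neg z) \<bullet> x) *\<^sub>R z)"
    by (simp add: reflection_def form_eq_inner inner_commute)
  then have "det (reflection z) = 1 - ((2 / form z z) *\<^sub>R flip_neg z) \<bullet> z"
    by (simp only: det_rank_one_update)
  also have "\<dots> = 1 - 2 / form z z * form z z"
    by (simp only: inner_scaleR_left form_eq_inner inner_commute[of z "flip_neg z"])
  finally show ?thesis
    using assms by simp
qed

lemma isometry_image_eqI: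
  assumes "isometry A" "\<sigma> \<in> XG" "(*v) A ` \<sigma> \<subseteq> \<sigma>"
  shows "(*v) A ` \<sigma> = \<sigma>"
  using isometry_image_XG[OF assms(1,2)] assms
  by (intro subspace_dim_equal) (auto simp: XG_def)

lemma reflection_image:
  assumes "\<sigma> \<in> XG" "form z z \<noteq> 0" "z \<in> \<sigma> \<or> z \<in> form_perp \<sigma>"
  shows "(*v) (reflection z) ` \<sigma> = \<sigma>"
proof (rule isometry_image_eqI[OF reflection_isometry[OF assms(2)] assms(1)])
  show "(*v) (reflection z) ` \<sigma> \<subseteq> \<sigma>"
  proof (rule image_subsetI)
    fix x assume x: "x \<in> \<sigma>"
    show "reflection z *v x \<in> \<sigma>"
    proof (cases "z \<in> \<sigma>")
      case True
      then show ?thesis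
        using x XG_subspace[OF assms(1)] by (simp add: reflection_mult subspace_diff subspace_scale)
    next
      case False
      then have "form x z = 0" using assms(3) x form_perpD by (metis form_commute)
      then show ?thesis using x by (simp add: reflection_mult)
    qed
  qed
qed

text \<open>Equal squares give \<open>form z z = 2 * form a z\<close> for \<open>z = a - a'\<close>,
  so the reflection subtracts exactly \<open>z\<close> from \<open>a\<close>.\<close>

lemma reflection_swap:
  assumes "form a a = form a' a'" "form (a - a') (a - a') \<noteq> 0"
  shows "reflection (a - a') *v a = a'"
proof -
  have "form (a - a') (a - a') = 2 * form a (a - a')"
    using assms(1) by (simp add: form_simps form_commute[of a' a])
  then show ?thesis
    using assms(2) by (simp add: reflection_mult)
qed

lemma reflection_fix: "form x z = 0 \<Longrightarrow> reflection z *v x = x"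
  by (simp add: reflection_mult)

text \<open>In a definite space the difference of two distinct vectors is never null, so one
  reflection exchanges them; it fixes everything orthogonal to \<open>W\<close>. Hence the motions
  for \<open>\<sigma>\<close> and for its complement do not disturb each other.\<close>

lemma definite_transitive:
  assumes \<sigma>: "\<sigma> \<in> XG" and W: "W = \<sigma> \<or> W = form_perp \<sigma>"
    and a: "a \<in> W" "a' \<in> W" "form a a = form a' a'"
  obtains A where "isometry A" "(*v) A ` \<sigma> = \<sigma>" "A *v a = a'"
    "\<And>x. (\<And>y. y \<in> W \<Longrightarrow> form x y = 0) \<Longrightarrow> A *v x = x"
proof (cases "a = a'")
  case True
  then show ?thesis by (intro that[of "mat 1"]) (auto simp: image_def)
next
  case False
  have z: "a - a' \<in> W"
    using a W XG_subspace[OF \<sigma>] subspace_form_perp subspace_diff by blast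
  then have nz: "form (a - a') (a - a') \<noteq> 0"
    using False W XG_neg[OF \<sigma>, of "a - a'"] form_perp_posdef[OF \<sigma>, of "a - a'"] by auto
  show ?thesis
    using z W reflection_isometry[OF nz] reflection_image[OF \<sigma> nz] reflection_swap[OF a(3) nz]
    by (intro that[of "reflection (a - a')"]) (auto intro: reflection_fix)
qed

text \<open>A product of reflections does the job up to the sign of its determinant, which a further
  reflection in a vector orthogonal to \<open>a'\<close> and \<open>b'\<close> corrects; such a vector exists since
  the dimension exceeds 2.\<close>

lemma maximal_compact_transitive:
  fixes \<tau> :: "('p::finite, 'q::finite) vec_pq set"
  assumes d: "CARD('p) + CARD('q) > 2" and \<tau>: "\<tau> \<in> XG"
    and a: "a \<in> \<tau>" "a' \<in> \<tau>" "form a a = form a' a'"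
    and b: "b \<in> form_perp \<tau>" "b' \<in> form_perp \<tau>" "form b b = form b' b'"
  obtains K where "K \<in> SO" "(*v) K ` \<tau> = \<tau>" "K *v a = a'" "K *v b = b'"
proof -
  obtain A where A: "isometry A" "(*v) A ` \<tau> = \<tau>" "A *v a = a'"
    "\<And>x. (\<And>y. y \<in> \<tau> \<Longrightarrow> form x y = 0) \<Longrightarrow> A *v x = x"
    using definite_transitive[OF \<tau> _ a] by blast
  obtain B where B: "isometry B" "(*v) B ` \<tau> = \<tau>" "B *v b = b'"
    "\<And>x. (\<And>y. y \<in> form_perp \<tau> \<Longrightarrow> form x y = 0) \<Longrightarrow> B *v x = x"
    using definite_transitive[OF \<tau> _ b] by blast
  have Ab: "A *v b = b"
    using b(1) by (intro A(4)) (simp add: form_perpD)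
  have Ba: "B *v a' = a'"
    using a(2) by (intro B(4)) (metis form_perpD form_commute)
  define K where "K = B ** A"
  have K: "isometry K" "(*v) K ` \<tau> = \<tau>" "K *v a = a'" "K *v b = b'"
    using A B Ab Ba image_image[of "(*v) B" "(*v) A" \<tau>]
    by (simp_all add: K_def isometry_mult matvec_simps)
  obtain z where z: "z \<in> \<tau> \<or> z \<in> form_perp \<tau>" "form z z \<noteq> 0" "form a' z = 0" "form b' z = 0"
  proof -
    \<comment> \<open>\<open>flip_neg\<close> turns orthogonality for the form into Euclidean
      orthogonality; two conditions in dimension above 2 leave a nonzero \<open>x\<close>.\<close>
    have "dim {flip_neg a', flip_neg b'} \<le> card {flip_neg a', flip_neg b'}"
      by (rule dim_le_card') simp
    also have "\<dots> \<le> 2" by (simp add: card_insert_if)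
    also have "2 < DIM(('p, 'q) vec_pq)" using d by simp
    finally obtain x where x: "x \<noteq> 0" "\<And>y. y \<in> span {flip_neg a', flip_neg b'} \<Longrightarrow> orthogonal x y"
      using orthogonal_to_subspace_exists by blast
    have x': "form x a' = 0" "form x b' = 0"
      using x(2)[of "flip_neg a'"] x(2)[of "flip_neg b'"]
      by (simp_all add: form_eq_inner orthogonal_def span_base)
    \<comment> \<open>\<open>x\<close> itself may be null. Its components in \<open>\<tau>\<close>
      and in the complement are orthogonal to \<open>a'\<close> and \<open>b'\<close> as well, and a
      nonzero component has nonzero square.\<close>
    let ?u = "form_proj \<tau> x"
    have u: "form ?u a' = 0" "form ?u b' = 0"
      using a b x' by (simp_all add: form_proj_selfadjoint[OF \<tau>] form_proj_id[OF \<tau>] form_proj_zero[OF \<tau>] form_simps)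
    show ?thesis
    proof (cases "?u = 0")
      case False
      then show ?thesis
        using XG_neg[OF \<tau> form_proj_in[OF \<tau>], of x] u form_proj_in[OF \<tau>, of x]
        by (intro that[of ?u]) (auto simp: form_commute[of a' ?u] form_commute[of b' ?u])
    next
      case True
      then have "x \<in> form_perp \<tau>" using form_proj_perp[OF \<tau>, of x] by simp
      then show ?thesis
        using form_perp_posdef[OF \<tau> _ x(1)] x'
        by (intro that[of x]) (auto simp: form_commute[of a' x] form_commute[of b' x])
    qed
  qed
  show ?thesis
  proof (cases "det K = 1")
    case True
    then show ?thesis using K by (intro that[of K]) (auto simp: SO_iff)
  next
    case False
    then have "det K = -1" using isometry_det[OF K(1)] by simp
    then have "reflection z ** K \<in> SO"
      using reflection_det[OF z(2)] reflection_isometry[OF z(2)] K(1)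
      by (simp add: SO_iff det_mul isometry_mult)
    then show ?thesis
      using K reflection_image[OF \<tau> z(2,1)] image_image[of "(*v) (reflection z)" "(*v) K" \<tau>] z
      by (intro that[of "reflection z ** K"]) (simp_all add: matvec_simps reflection_fix)
  qed
qed

section \<open>The polar projection\<close>

text \<open>The involution is minus the reflection in \<open>v\<close>. The vector \<open>?y\<close>
  in the proof is the part of \<open>x\<close> orthogonal to \<open>v\<close>; its plus sign comes
  from \<open>form v v = -1\<close>.\<close>

lemma J_inv_span:
  assumes v: "form v v = -1"
  shows "J_inv (span {v}) *v x = - x - (2 * form x v) *\<^sub>R v"
proof -
  define J where "J = matrix (\<lambda>x. - x - (2 * form x v) *\<^sub>R v)"
  have J: "J *v x = - x - (2 * form x v) *\<^sub>R v" for x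
    unfolding J_def by (rule matrix_apply) (auto intro!: linearI simp: form_simps algebra_simps)
  have "J_inv (span {v}) = J"
    unfolding J_inv_def
  proof (rule the_equality)
    have "J *v x = x" if x_in: "x \<in> span {v}" for x
    proof -
      obtain k where x: "x = k *\<^sub>R v" using x_in unfolding span_singleton by blast
      have "J *v x = (- k - 2 * (k * form v v)) *\<^sub>R v"
        by (simp add: x J form.scaleR_left scaleR_diff_left)
      then show ?thesis by (simp add: v x)
    qed
    moreover have "J *v x = - x" if "x \<in> form_perp (span {v})" for x
      using form_perpD[OF that, of v] by (simp add: J span_base)
    ultimately show "(\<forall>x\<in>span {v}. J *v x = x) \<and> (\<forall>x\<in>form_perp (span {v}). J *v x = - x)"
      by blast
  next
    fix J' assume J': "(\<forall>x\<in>span {v}. J' *v x = x) \<and> (\<forall>x\<in>form_perp (span {v}). J' *v x = - x)"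
    show "J' = J"
    proof (rule matrix_eqI)
      fix x
      let ?y = "x + form x v *\<^sub>R v"
      have "form ?y v = 0" using v by (simp add: form_simps)
      then have "?y \<in> form_perp (span {v})"
        by (auto simp: form_perp_def span_singleton form_simps)
      then have "J' *v ?y = - ?y" and "J' *v v = v"
        using J' by (auto simp: span_base)
      moreover have "J' *v ?y = J' *v x + form x v *\<^sub>R (J' *v v)"
        by (simp add: matvec_simps)
      ultimately have "J' *v x + form x v *\<^sub>R v = - x - form x v *\<^sub>R v"
        by simp
      then have "J' *v x = - x - form x v *\<^sub>R v - form x v *\<^sub>R v"
        by (simp only: eq_diff_eq)
      then show "J' *v x = J *v x"
        by (simp only: J mult_2 scaleR_add_left diff_diff_eq)
    qed
  qed
  then show ?thesis by (simp add: J)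
qed

text \<open>Anticommuting with the involution, \<open>X\<close> exchanges the line of
  \<open>v\<close> and its complement; being skew, it is then determined by
  \<open>X *v v\<close>.\<close>

lemma q_space_wedge:
  assumes v: "form v v = -1" and X: "X \<in> q_space (span {v})"
  shows "X = wedge v (X *v v)"
proof -
  have so: "X \<in> so" and JXJ: "J_inv (span {v}) ** X ** J_inv (span {v}) = - X"
    using X by (auto simp: q_space_def)
  note J = J_inv_span[OF v]
  have vXv: "form v (X *v v) = 0"
    using so_skew[OF so, of v v] by (simp add: form_commute)
  have perp: "X *v y = form y (X *v v) *\<^sub>R v" if y: "form y v = 0" for y
  proof -
    have "J_inv (span {v}) *v (X *v (J_inv (span {v}) *v y)) = - (X *v y)"
      using arg_cong[OF JXJ, of "\<lambda>A. A *v y"] by (simp add: matvec_simps)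
    \<comment> \<open>A vector fixed by the involution is a multiple of \<open>v\<close>.\<close>
    then have "J_inv (span {v}) *v (X *v y) = X *v y"
      using y by (simp add: J[of y] matvec_simps)
    then have eq: "X *v y = - (X *v y) - (2 * form (X *v y) v) *\<^sub>R v"
      using J[of "X *v y"] by (rule trans[OF sym])
    have "2 *\<^sub>R (X *v y) = X *v y + X *v y"
      by (rule scaleR_2)
    also have "\<dots> = X *v y + (- (X *v y) - (2 * form (X *v y) v) *\<^sub>R v)"
      using arg_cong[OF eq, of "\<lambda>z. X *v y + z"] .
    also have "\<dots> = 2 *\<^sub>R (- form (X *v y) v *\<^sub>R v)"
      by simp
    finally have "X *v y = - form (X *v y) v *\<^sub>R v"
      by (simp only: scaleR_cancel_left) simp
    then show ?thesis using so_skew[OF so, of y v] by simp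
  qed
  show ?thesis
  proof (rule matrix_eqI)
    fix x
    let ?y = "x + form x v *\<^sub>R v"
    have "form ?y v = 0" using v by (simp add: form_simps)
    from perp[OF this] have "X *v x + form x v *\<^sub>R (X *v v) = form x (X *v v) *\<^sub>R v"
      by (simp add: matvec_simps form_simps vXv)
    then show "X *v x = wedge v (X *v v) *v x"
      by (simp add: wedge_mult eq_diff_eq)
  qed
qed

section \<open>Generators of the Weyl chambers\<close>

lemma wedge_scaleR_right: "wedge a (c *\<^sub>R b) = c *\<^sub>R wedge a b"
  by (rule matrix_eqI) (simp add: wedge_mult matvec_simps form_simps algebra_simps)

lemma Hpq_unit:
  assumes "\<omega> \<in> Hpq"
  obtains v where "\<omega> = span {v}" "form v v = -1"
proof -
  obtain u where u: "\<omega> = span {u}" "form u u < 0"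
    using assms by (auto simp: Hpq_def)
  define c where "c = 1 / sqrt (- form u u)"
  have c: "c \<noteq> 0" using u(2) by (simp add: c_def)
  have "c\<^sup>2 = 1 / (- form u u)"
    using u(2) by (simp add: c_def power_divide)
  then have "form (c *\<^sub>R u) (c *\<^sub>R u) = -1"
    using u(2) by (simp add: form_simps power2_eq_square[symmetric] mult.assoc[symmetric])
  moreover have "(1 / c) *\<^sub>R (c *\<^sub>R u) \<in> span {c *\<^sub>R u}"
    by (intro span_scale span_base) simp
  then have "\<omega> = span {c *\<^sub>R u}"
    using c unfolding u(1) span_eq by (simp add: span_scale span_base)
  ultimately show ?thesis using that by blast
qed

text \<open>By \<open>q_space_wedge\<close> a generator is \<open>wedge v u\<close>, and membership
  in \<open>p_space \<tau>\<close> forces \<open>u\<close> into the complement of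
  \<open>\<tau>\<close>, where the form is positive. Rescaling \<open>u\<close> by a positive factor
  keeps the half-line.\<close>

lemma weyl_chamber_generator:
  assumes v: "form v v = -1" and \<tau>: "\<tau> \<in> XG" "v \<in> \<tau>"
    and b: "b \<subseteq> p_space \<tau> \<inter> q_space (span {v})" and chamber: "closed_weyl_chamber b bplus"
  obtains w where "w \<in> form_perp \<tau>" "form w w = 1" "bplus = {t *\<^sub>R wedge v w | t. t \<ge> 0}"
proof -
  obtain X where X: "X \<in> b" "X \<noteq> 0" "bplus = {t *\<^sub>R X | t. t \<ge> 0}"
    using chamber by (auto simp: closed_weyl_chamber_def)
  define u where "u = X *v v"
  have Xu: "X = wedge v u"
    using q_space_wedge[OF v, of X] X(1) b by (auto simp: u_def)
  have "X ** proj_mat \<tau> + proj_mat \<tau> ** X = X"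
    using X(1) b p_space_iff[OF \<tau>(1)] by blast
  then have "(X ** proj_mat \<tau> + proj_mat \<tau> ** X) *v v = u"
    by (simp add: u_def)
  then have "form_proj \<tau> u = 0"
    using \<tau> by (simp add: matvec_simps proj_mat_mult form_proj_id u_def)
  then have u_perp: "u \<in> form_perp \<tau>"
    using form_proj_perp[OF \<tau>(1), of u] by simp
  have "u \<noteq> 0"
    using X(2) Xu wedge_scaleR_right[of v 0 u] by auto
  then have pos: "form u u > 0"
    using form_perp_posdef[OF \<tau>(1) u_perp] by simp
  define c where "c = sqrt (form u u)"
  have c: "c > 0" "c\<^sup>2 = form u u" using pos by (auto simp: c_def)
  define w where "w = (1 / c) *\<^sub>R u"
  have uw: "u = c *\<^sub>R w" using c by (simp add: w_def)
  have "w \<in> form_perp \<tau>"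
    unfolding w_def by (intro subspace_scale subspace_form_perp u_perp)
  moreover have "form w w = 1"
    using c pos by (simp add: w_def form_simps power2_eq_square field_simps)
  moreover have "bplus = {t *\<^sub>R wedge v w | t. t \<ge> 0}"
  proof -
    have "t *\<^sub>R X = (t * c) *\<^sub>R wedge v w" for t
      by (simp add: Xu uw wedge_scaleR_right)
    moreover have "t *\<^sub>R wedge v w = (t / c) *\<^sub>R X" for t
      using c by (simp add: Xu uw wedge_scaleR_right)
    moreover have "0 \<le> t * c" "0 \<le> t / c" if "0 \<le> t" for t
      using that c(1) by simp_all
    ultimately show ?thesis
      unfolding X(3) by blast
  qed
  ultimately show ?thesis by (rule that)
qed

text \<open>\<open>wedge v w\<close> exchanges \<open>v\<close> and \<open>w\<close>, so its flow is
  a hyperbolic rotation of their plane.\<close>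

lemma mexp_wedge:
  assumes v: "form v v = -1" and w: "form w w = 1" and vw: "form v w = 0"
  shows "mexp (t *\<^sub>R wedge v w) *v v = cosh t *\<^sub>R v + sinh t *\<^sub>R w"
proof -
  define y where "y t = cosh t *\<^sub>R v + sinh t *\<^sub>R w" for t
  have X: "wedge v w *v v = w" "wedge v w *v w = v"
    using v w vw form_commute[of w v] by (simp_all add: wedge_mult)
  have "(y has_vector_derivative wedge v w *v y s) (at s)" for s
    unfolding y_def
    by (auto simp: X matvec_simps intro!: derivative_eq_intros)
  from mexp_unique[OF this, of t] show ?thesis by (simp add: y_def)
qed

section \<open>The gap under group elements and the polar decomposition\<close>

lemma gap_isometry:
  assumes "isometry A" "\<sigma> \<in> XG"
  shows "gap (A *v v) ((*v) A ` \<sigma>) = gap v \<sigma>"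
  using assms
  by (simp add: gap_def isometry_form_proj isometryD flip: matvec.diff_right)

lemma gap_scaleR:
  assumes "\<sigma> \<in> XG"
  shows "gap (c *\<^sub>R v) \<sigma> = c\<^sup>2 * gap v \<sigma>"
proof -
  have "c *\<^sub>R v - form_proj \<sigma> (c *\<^sub>R v) = c *\<^sub>R (v - form_proj \<sigma> v)"
    by (simp add: linear_scale[OF linear_form_proj[OF assms]] scaleR_diff_right)
  then show ?thesis
    by (simp add: gap_def form.scaleR_left form.scaleR_right power2_eq_square)
qed

lemma gap_cosh_sinh:
  assumes "\<tau> \<in> XG" "v \<in> \<tau>" "w \<in> form_perp \<tau>" "form w w = 1"
  shows "gap (cosh t *\<^sub>R v + sinh t *\<^sub>R w) \<tau> = (sinh t)\<^sup>2"
proof -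
  note lin = linear_form_proj[OF assms(1)]
  have "form_proj \<tau> (cosh t *\<^sub>R v + sinh t *\<^sub>R w) = cosh t *\<^sub>R v"
    using assms by (simp add: linear_add[OF lin] linear_scale[OF lin] form_proj_id form_proj_zero)
  then show ?thesis
    using assms(4) by (simp add: gap_def form_simps power2_eq_square)
qed

lemma arsinh_nonneg: "0 \<le> x \<Longrightarrow> 0 \<le> arsinh x" for x :: real
  using arsinh_real_neg_iff[of x] by linarith

text \<open>The components of \<open>A *v v\<close> in \<open>\<tau>\<close> and in the complement
  have squares -cosh^2 and sinh^2 of the parameter. So some \<open>K\<close> stabilizing
  \<open>\<tau>\<close> carries the hyperbolically rotated \<open>v\<close> to
  \<open>A *v v\<close>, and the remaining factor \<open>H\<close> fixes \<open>v\<close>.\<close>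

lemma polar_decomposition_exists:
  fixes \<tau> :: "('p::finite, 'q::finite) vec_pq set"
  assumes d: "CARD('p) + CARD('q) > 2" and \<tau>: "\<tau> \<in> XG" "v \<in> \<tau>"
    and v: "form v v = -1" and w: "w \<in> form_perp \<tau>" "form w w = 1" and A: "A \<in> SO"
  obtains K H where "K \<in> SO" "(*v) K ` \<tau> = \<tau>" "H \<in> SO" "H *v v = v"
    "A = K ** mexp (arsinh (sqrt (gap (A *v v) \<tau>)) *\<^sub>R wedge v w) ** H"
proof -
  let ?t = "arsinh (sqrt (gap (A *v v) \<tau>))"
  let ?E = "mexp (?t *\<^sub>R wedge v w)"
  let ?u = "A *v v"
  have vw: "form v w = 0" using form_perpD[OF w(1) \<tau>(2)] by (simp add: form_commute)
  have E: "?E \<in> SO" by (intro mexp_SO so_scaleR wedge_so)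
  have gap_nn: "0 \<le> gap ?u \<tau>" using gap_nonneg[OF \<tau>(1)] .
  have sinh: "(sinh ?t)\<^sup>2 = gap ?u \<tau>" using gap_nn by simp
  have cosh: "(cosh ?t)\<^sup>2 = 1 + gap ?u \<tau>" using sinh by (simp add: cosh_square_eq)
  have uu: "form ?u ?u = -1" using isometryD[OF SO_isometry[OF A]] v by simp
  obtain K where K: "K \<in> SO" "(*v) K ` \<tau> = \<tau>" "K *v (cosh ?t *\<^sub>R v) = form_proj \<tau> ?u"
    "K *v (sinh ?t *\<^sub>R w) = ?u - form_proj \<tau> ?u"
  proof (rule maximal_compact_transitive[OF d \<tau>(1)])
    show "cosh ?t *\<^sub>R v \<in> \<tau>" using \<tau> by (simp add: XG_subspace subspace_scale)
    show "sinh ?t *\<^sub>R w \<in> form_perp \<tau>" using w by (simp add: subspace_form_perp subspace_scale)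
    show "form_proj \<tau> ?u \<in> \<tau>" "?u - form_proj \<tau> ?u \<in> form_perp \<tau>"
      using form_proj[OF \<tau>(1)] by auto
    show "form (cosh ?t *\<^sub>R v) (cosh ?t *\<^sub>R v) = form (form_proj \<tau> ?u) (form_proj \<tau> ?u)"
      using cosh gap_eq(2)[OF \<tau>(1), of ?u] uu v by (simp add: form_simps power2_eq_square)
    show "form (sinh ?t *\<^sub>R w) (sinh ?t *\<^sub>R w) = form (?u - form_proj \<tau> ?u) (?u - form_proj \<tau> ?u)"
      using sinh w(2) by (simp add: gap_def form_simps(9,10) power2_eq_square)
  qed
  define H where "H = matrix_inv ?E ** matrix_inv K ** A"
  have KE: "K *v (?E *v v) = A *v v"
    using K(3,4) by (simp add: mexp_wedge[OF v w(2) vw] matvec.add_right)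
  have "matrix_inv K *v (A *v v) = ?E *v v"
    using isometry_inverse_mult(2)[OF SO_isometry[OF K(1)], of "?E *v v"] by (simp only: KE)
  then have "H *v v = v"
    using isometry_inverse_mult(2)[OF SO_isometry[OF E], of v]
    by (simp only: H_def matrix_vector_mul_assoc[symmetric])
  moreover have "H \<in> SO" by (simp add: H_def SO_mult SO_inv E K(1) A)
  moreover have "A = K ** ?E ** H"
    by (metis (no_types) H_def SO_inv_mult(1) E K(1) matrix_mul_assoc matrix_mul_lid matrix_mul_rid)
  ultimately show ?thesis using K that by blast
qed

text \<open>For uniqueness, the gap of \<open>A *v v\<close> is evaluated on an arbitrary
  decomposition: \<open>K\<close> does not change it and \<open>mexp Y\<close> contributes
  \<open>(sinh t)\<^sup>2\<close>, from which \<open>t \<ge> 0\<close> is recovered.\<close>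

lemma polar_proj_eq:
  fixes \<tau> :: "('p::finite, 'q::finite) vec_pq set"
  assumes d: "CARD('p) + CARD('q) > 2" and \<tau>: "\<tau> \<in> XG" "v \<in> \<tau>"
    and v: "form v v = -1" and w: "w \<in> form_perp \<tau>" "form w w = 1" and A: "A \<in> SO"
    and bplus: "bplus = {t *\<^sub>R wedge v w | t. t \<ge> 0}"
  shows "polar_proj (span {v}) \<tau> bplus (projectivize A) =
    arsinh (sqrt (gap (A *v v) \<tau>)) *\<^sub>R wedge v w"
  unfolding polar_proj_def
proof (rule the_equality)
  let ?t = "arsinh (sqrt (gap (A *v v) \<tau>))"
  have stab_\<tau>: "k \<in> stabilizer \<tau> \<longleftrightarrow> (\<exists>K\<in>SO. k = projectivize K \<and> (*v) K ` \<tau> = \<tau>)" for k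
    using stabilizer_iff[OF XG_subspace[OF \<tau>(1)]] .
  have stab_v: "h \<in> stabilizer (span {v}) \<longleftrightarrow> (\<exists>H\<in>SO. h = projectivize H \<and> (*v) H ` span {v} = span {v})" for h
    using stabilizer_iff[OF subspace_span] .
  have E: "mexp (t *\<^sub>R wedge v w) \<in> SO" for t by (intro mexp_SO so_scaleR wedge_so)
  obtain K H where K: "K \<in> SO" "(*v) K ` \<tau> = \<tau>" and H: "H \<in> SO" "H *v v = v"
    and decomp: "A = K ** mexp (?t *\<^sub>R wedge v w) ** H"
    using polar_decomposition_exists[OF d \<tau> v w A] .
  have "(*v) H ` span {v} = span {v}"
    using linear_span_image[of "(*v) H" "{v}"] H(2) by simp
  then have "projectivize H \<in> stabilizer (span {v})"
    using stab_v H(1) by blast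
  moreover have "projectivize K \<in> stabilizer \<tau>"
    using stab_\<tau> K by blast
  moreover have "projectivize A = projectivize K \<otimes>\<^bsub>PSO\<^esub> projectivize (mexp (?t *\<^sub>R wedge v w)) \<otimes>\<^bsub>PSO\<^esub> projectivize H"
    using K(1) H(1) E decomp by (simp add: projectivize_mult SO_det SO_mult)
  moreover have "?t \<ge> 0"
    using gap_nonneg[OF \<tau>(1)] by (simp add: arsinh_nonneg)
  ultimately show "?t *\<^sub>R wedge v w \<in> bplus \<and>
    (\<exists>k\<in>stabilizer \<tau>. \<exists>h\<in>stabilizer (span {v}).
      projectivize A = k \<otimes>\<^bsub>PSO\<^esub> projectivize (mexp (?t *\<^sub>R wedge v w)) \<otimes>\<^bsub>PSO\<^esub> h)"
    unfolding bplus by blast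
next
  have vw: "form v w = 0" using form_perpD[OF w(1) \<tau>(2)] by (simp add: form_commute)
  fix Y
  assume Y: "Y \<in> bplus \<and> (\<exists>k\<in>stabilizer \<tau>. \<exists>h\<in>stabilizer (span {v}).
      projectivize A = k \<otimes>\<^bsub>PSO\<^esub> projectivize (mexp Y) \<otimes>\<^bsub>PSO\<^esub> h)"
  then obtain t where t: "t \<ge> 0" "Y = t *\<^sub>R wedge v w"
    unfolding bplus by blast
  obtain k h where k: "k \<in> stabilizer \<tau>" and h: "h \<in> stabilizer (span {v})"
    and kh: "projectivize A = k \<otimes>\<^bsub>PSO\<^esub> projectivize (mexp Y) \<otimes>\<^bsub>PSO\<^esub> h"
    using Y by blast
  obtain K where K: "K \<in> SO" "(*v) K ` \<tau> = \<tau>" and kK: "k = projectivize K"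
    using k stabilizer_iff[OF XG_subspace[OF \<tau>(1)]] by blast
  obtain H where H: "H \<in> SO" "(*v) H ` span {v} = span {v}" and hH: "h = projectivize H"
    using h stabilizer_iff[OF subspace_span] by blast
  note eq = kh[unfolded kK hH]
  have E: "mexp Y \<in> SO" unfolding t(2) by (intro mexp_SO so_scaleR wedge_so)
  let ?B = "K ** mexp Y"
  have B: "?B \<in> SO" using K(1) E by (rule SO_mult)
  have "projectivize A = projectivize (?B ** H)"
    using K(1) H(1) E eq by (simp add: projectivize_mult SO_det SO_mult)
  then obtain c where c: "A = c *\<^sub>R (?B ** H)"
    using projectivize_self[OF SO_det[OF A]] projectivize_mem by blast
  have "H *v v \<in> span {v}" using H(2) by (auto simp: span_base)
  then obtain r where r: "H *v v = r *\<^sub>R v" by (auto simp: span_singleton)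
  have Av: "A *v v = (c * r) *\<^sub>R (?B *v v)"
    by (simp add: c matvec_simps r)
  \<comment> \<open>\<open>c\<close> relates two representatives of one class and \<open>r\<close>
    is the action of \<open>H\<close> on the line. Comparing norms leaves only a sign, which
    \<open>gap_scaleR\<close> squares away.\<close>
  have "(c * r)\<^sup>2 = 1"
    using arg_cong[OF Av, of "\<lambda>x. form x x"] isometryD[OF SO_isometry[OF A], of v v]
      isometryD[OF SO_isometry[OF B], of v v] v
    by (simp add: form.scaleR_left form.scaleR_right power2_eq_square)
  then have "gap (A *v v) \<tau> = gap (K *v (mexp Y *v v)) \<tau>"
    unfolding Av gap_scaleR[OF \<tau>(1)] by (simp add: matvec_simps)
  also have "\<dots> = gap (mexp Y *v v) \<tau>"
    using gap_isometry[OF SO_isometry[OF K(1)] \<tau>(1)] K(2) by simp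
  also have "\<dots> = (sinh t)\<^sup>2"
    unfolding t(2) mexp_wedge[OF v w(2) vw] by (rule gap_cosh_sinh[OF \<tau> w])
  finally show "Y = arsinh (sqrt (gap (A *v v) \<tau>)) *\<^sub>R wedge v w"
    using t by (simp add: arsinh_sinh_real)
qed

theorem proposition3p5:
  fixes \<omega> \<tau> :: "('p::finite, 'q::finite) vec_pq set"
    and b bplus :: "('p, 'q) mat_pq set"
    and g :: "('p, 'q) mat_pq set"
  assumes "CARD('p) + CARD('q) > 2"
    and "\<omega> \<in> Hpq"
    and "\<tau> \<in> S_sub \<omega>"
    and "maximal_subalgebra_in (p_space \<tau> \<inter> q_space \<omega>) b"
    and "closed_weyl_chamber b bplus"
    and "g \<in> carrier PSO"
  shows "sqrt (abs_q (polar_proj \<omega> \<tau> bplus g)) =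
         dist_XG_set (act (inv\<^bsub>PSO\<^esub> g) \<tau>) (S_sub \<omega>)"
proof -
  note d = assms(1)
  obtain v where \<omega>: "\<omega> = span {v}" and v: "form v v = -1"
    using Hpq_unit[OF assms(2)] .
  have S: "\<sigma> \<in> S_sub \<omega> \<longleftrightarrow> \<sigma> \<in> XG \<and> v \<in> \<sigma>" for \<sigma>
    using XG_subspace[of \<sigma>] span_minimal[of "{v}" \<sigma>] span_base[of v "{v}"]
    by (auto simp: S_sub_def \<omega>)
  have \<tau>: "\<tau> \<in> XG" "v \<in> \<tau>" using assms(3) S by auto
  obtain w where w: "w \<in> form_perp \<tau>" "form w w = 1" and bplus: "bplus = {t *\<^sub>R wedge v w | t. t \<ge> 0}"
    using weyl_chamber_generator[OF v \<tau> _ assms(5)] assms(4)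
    unfolding maximal_subalgebra_in_def \<omega> by blast
  obtain A where A: "A \<in> SO" and g: "g = projectivize A"
    using assms(6) by (auto simp: carrier_PSO)
  define t where "t = arsinh (sqrt (gap (A *v v) \<tau>))"
  let ?X = "t *\<^sub>R wedge v w"
  have t: "t \<ge> 0" using gap_nonneg[OF \<tau>(1)] by (simp add: t_def arsinh_nonneg)
  have vw: "form v w = 0" using form_perpD[OF w(1) \<tau>(2)] by (simp add: form_commute)
  \<comment> \<open>\<open>wedge v w\<close> is a unit vector for half the trace form, so
    \<open>t\<close> is arc length.\<close>
  have trace: "trace (?X ** ?X) = 2 * t\<^sup>2"
  proof -
    have "trace (?X ** ?X) = t\<^sup>2 * trace (wedge v w ** wedge v w)"
      by (simp add: trace_def matmul_simps sum_distrib_left power2_eq_square mult.assoc)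
    also have "trace (wedge v w ** wedge v w) = 2"
      using v w vw form_commute[of w v] by (simp add: trace_mult_wedge wedge_mult form_simps)
    finally show ?thesis by simp
  qed
  obtain K H where K: "K \<in> SO" "(*v) K ` \<tau> = \<tau>" and H: "H \<in> SO" "H *v v = v"
    and decomp: "A = K ** mexp ?X ** H"
    using polar_decomposition_exists[OF d \<tau> v w A] unfolding t_def .
  define \<sigma> where "\<sigma> = (*v) (matrix_inv A) ` \<tau>"
  have \<sigma>_act: "act (inv\<^bsub>PSO\<^esub> g) \<tau> = \<sigma>"
    unfolding g inv_PSO[OF A] \<sigma>_def
    by (rule act_projectivize[OF SO_det[OF SO_inv[OF A]] XG_subspace[OF \<tau>(1)]])
  note isoAi = SO_isometry[OF SO_inv[OF A]] and isoHi = SO_isometry[OF SO_inv[OF H(1)]]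
  have \<sigma>: "\<sigma> \<in> XG" unfolding \<sigma>_def by (rule isometry_image_XG[OF isoAi \<tau>(1)])
  have gap_\<sigma>: "gap v \<sigma> = gap (A *v v) \<tau>"
    using gap_isometry[OF isoAi \<tau>(1), of "A *v v"]
    by (simp add: \<sigma>_def isometry_inverse_mult SO_isometry A)
  \<comment> \<open>On \<open>S_sub \<omega>\<close> the gap vanishes, so the bound of
    \<open>dist_XG_ge\<close> becomes \<open>t\<close>.\<close>
  have lower: "t \<le> dist_XG \<sigma> \<sigma>'" if "\<sigma>' \<in> S_sub \<omega>" for \<sigma>'
  proof -
    have "\<sigma>' \<in> XG" "gap v \<sigma>' = 0"
      using that S by (auto simp: gap_def form_proj_id form_simps)
    then show ?thesis
      using dist_XG_ge[OF d \<sigma> \<open>\<sigma>' \<in> XG\<close> v] by (simp add: gap_\<sigma> t_def)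
  qed
  \<comment> \<open>The nearest point: since \<open>H\<close> fixes \<open>v\<close>, its inverse
    carries \<open>\<tau>\<close> to another subspace containing \<open>v\<close>.\<close>
  define \<sigma>\<^sub>0 where "\<sigma>\<^sub>0 = (*v) (matrix_inv H) ` \<tau>"
  have \<sigma>\<^sub>0: "\<sigma>\<^sub>0 \<in> XG" unfolding \<sigma>\<^sub>0_def by (rule isometry_image_XG[OF isoHi \<tau>(1)])
  have "matrix_inv H *v v = v"
    using isometry_inverse_mult(2)[OF SO_isometry[OF H(1)], of v] H(2) by simp
  then have \<sigma>\<^sub>0_S: "\<sigma>\<^sub>0 \<in> S_sub \<omega>"
    using \<sigma>\<^sub>0 \<tau>(2) unfolding S \<sigma>\<^sub>0_def by (metis imageI)
  define Y where "Y = matrix_inv H ** ?X ** matrix_inv (matrix_inv H)"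
  have invH: "invertible (matrix_inv H)" by (rule isometry_invertible[OF isoHi])
  have "?X \<in> p_space \<tau>"
    using wedge_p_space[OF \<tau> w(1)] p_space_iff[OF \<tau>(1)]
    by (simp add: so_scaleR matmul_simps flip: scaleR_add_right)
  then have Y: "Y \<in> p_space \<sigma>\<^sub>0"
    unfolding Y_def \<sigma>\<^sub>0_def by (rule isometry_conj_p_space[OF isoHi \<tau>(1)])
  have \<sigma>_Y: "(*v) (mexp (- Y)) ` \<sigma>\<^sub>0 = \<sigma>"
  proof -
    \<comment> \<open>From A = K exp(X) H follows A^-1 K = H^-1 exp(-X) = exp(-Y) H^-1. As
      \<open>K\<close> preserves \<open>\<tau>\<close>, exp(-Y) carries
      \<open>\<sigma>\<^sub>0\<close> to \<open>\<sigma>\<close>.\<close>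
    have HiA: "mexp (- Y) ** matrix_inv H = matrix_inv A ** K"
    proof -
      have "- Y = matrix_inv H ** (- ?X) ** matrix_inv (matrix_inv H)"
        by (simp add: Y_def matmul_simps)
      then have "mexp (- Y) = matrix_inv H ** mexp (- ?X) ** matrix_inv (matrix_inv H)"
        by (simp only: mexp_conj[OF invH])
      then have "mexp (- Y) ** matrix_inv H = matrix_inv H ** mexp (- ?X)"
        by (simp only: matrix_mul_assoc[symmetric] matrix_inv_mult(2)[OF invH] matrix_mul_rid)
      moreover have "A ** (matrix_inv H ** mexp (- ?X)) = K"
        unfolding decomp
        by (metis SO_inv_mult(1)[OF H(1)] matrix_mul_assoc matrix_mul_rid mexp_neg_right)
      ultimately show ?thesis
        by (metis SO_inv_mult(2)[OF A] matrix_mul_assoc matrix_mul_lid)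
    qed
    have "(*v) (mexp (- Y)) ` \<sigma>\<^sub>0 = (*v) (mexp (- Y) ** matrix_inv H) ` \<tau>"
      by (simp add: \<sigma>\<^sub>0_def image_image matvec_simps)
    also have "\<dots> = (*v) (matrix_inv A) ` (*v) K ` \<tau>"
      by (simp add: HiA image_image matvec_simps)
    finally show ?thesis by (simp add: K(2) \<sigma>_def)
  qed
  have "normalized_killing Y Y = t\<^sup>2"
  proof -
    let ?M = "matrix_inv H"
    have "Y ** Y = ?M ** ?X ** (matrix_inv ?M ** ?M) ** ?X ** matrix_inv ?M"
      by (simp only: Y_def matrix_mul_assoc)
    then have "Y ** Y = ?M ** (?X ** ?X) ** matrix_inv ?M"
      by (simp only: matrix_inv_mult(2)[OF invH] matrix_mul_rid matrix_mul_assoc)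
    then show ?thesis
      by (simp add: normalized_killing_eq[OF d] trace_conj[OF invH] trace)
  qed
  then have upper: "dist_XG \<sigma> \<sigma>\<^sub>0 \<le> t"
    using dist_XG_mexp_le[OF d \<sigma>\<^sub>0 Y] t by (simp add: \<sigma>_Y)
  have "dist_XG_set \<sigma> (S_sub \<omega>) = t"
    unfolding dist_XG_set_def
  proof (rule antisym)
    show "(INF \<sigma>'\<in>S_sub \<omega>. dist_XG \<sigma> \<sigma>') \<le> t"
      using \<sigma>\<^sub>0_S lower upper by (intro cINF_lower2 bdd_belowI2) auto
    show "t \<le> (INF \<sigma>'\<in>S_sub \<omega>. dist_XG \<sigma> \<sigma>')"
      using \<sigma>\<^sub>0_S lower by (intro cINF_greatest) auto
  qed
  moreover have "sqrt (abs_q (polar_proj \<omega> \<tau> bplus g)) = t"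
    unfolding \<omega> g polar_proj_eq[OF d \<tau> v w A bplus] t_def[symmetric] abs_q_def
      normalized_killing_eq[OF d] trace using t by simp
  ultimately show ?thesis by (simp add: \<sigma>_act)
qed

end
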